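(* Let $n\ge2$, $n\ne3$. The Green functions $\bar G^{(i,j)}$ on $\mathbb{B}^{n+1}$ for the boundary operator pairs $(\mathscr{B}^3_i,\mathscr{B}^3_j)$ are $$\bar G^{(0,1)}(\xi,\eta)=\Gamma(\xi-\eta)+\tfrac12\Gamma(|\xi|\cdot|\xi^\ast-\eta|)\Big[(n-3)\frac{|\xi-\eta|^2}{|\xi|^2\cdot|\xi^\ast-\eta|^2}-(n-1)\Big],$$ $$\bar G^{(2,3)}(\xi,\eta)=\Gamma(\xi-\eta)-\tfrac12\Gamma(|\xi|\cdot|\xi^\ast-\eta|)\Big[(n-3)\frac{|\xi-\eta|^2}{|\xi|^2\cdot|\xi^\ast-\eta|^2}-(n-1)\Big],$$ $$\bar G^{(0,2)}(\xi,\eta)=\Gamma(\xi-\eta)-\Gamma(|\xi|\cdot|\xi^\ast-\eta|),\qquad \bar G^{(1,3)}(\xi,\eta)=\Gamma(\xi-\eta)+\Gamma(|\xi|\cdot|\xi^\ast-\eta|),$$ for all $\xi,\eta\in\mathbb{B}^{n+1}$, $\xi\ne\eta$. Moreover, there holds $$0\le\bar G^{(0,1)}(\xi,\eta)\le\bar G^{(0,2)}(\xi,\eta)\le\bar G^{(1,3)}(\xi,\eta)\le\bar G^{(2,3)}(\xi,\eta),\qquad\forall\,\xi,\eta\in\overline{\mathbb{B}^{n+1}},\ \xi\ne\eta,$$ with equality if and only if either $\xi\in\mathbb{S}^n$ or $\eta\in\mathbb{S}^n$.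
   Context: $\mathbb{B}^{n+1}$ is the open unit ball of $\mathbb{R}^{n+1}$, $\mathbb{S}^n$ its boundary, $r=|\xi|$, $\Delta$ is the Laplacian on $\mathbb{R}^{n+1}$, $\Delta_{\mathbb{S}^n}$ the Laplace–Beltrami operator. $\xi^\ast=|\xi|^{-2}\xi$ for $\xi\neq0$; the quantity $|\xi||\xi^\ast-\eta|$ is defined for all $\xi,\eta$ by $|\xi|^2|\xi^\ast-\eta|^2=|\xi-\eta|^2+(1-|\xi|^2)(1-|\eta|^2)$. For $n\ne3$, $\Gamma(\xi-\eta)=\Gamma(|\xi-\eta|)$ with $\Gamma(\rho)=\frac{1}{2(n-1)(n-3)|\mathbb{S}^n|}\rho^{3-n}$, the fundamental solution of $\Delta^2$ in $\mathbb{R}^{n+1}$. The conformal boundary operators on $\mathbb{S}^n$ are $\mathscr{B}^3_0(U)=U$ and $$\mathscr{B}^3_1(U)=\frac{\partial U}{\partial r}+\frac{n-3}{2}U,\qquad \mathscr{B}^3_2(U)=\frac{\partial^2U}{\partial r^2}-\Delta_{\mathbb{S}^n}U+(n-2)\frac{\partial U}{\partial r}+\frac{(n-3)(n-1)}{2}U,$$ $$\mathscr{B}^3_3(U)=-\frac{\partial\Delta U}{\partial r}-2\Delta_{\mathbb{S}^n}\frac{\partial U}{\partial r}-\frac{n-3}{2}\frac{\partial^2U}{\partial r^2}-\frac{3n-5}{2}\Delta_{\mathbb{S}^n}U+\frac{n-3}{2}\frac{\partial U}{\partial r}+\frac{(n^2-1)(n-3)}{4}U .$$ A Green function $\bar G^{(i,j)}$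 for the problem $\Delta^2U=\bar f$ in $\mathbb{B}^{n+1}$, $\mathscr{B}^3_iU=\mathscr{B}^3_jU=0$ on $\mathbb{S}^n$ (with $i,j\in\{0,1,2,3\}$, $i<j$, $i+j\ne3$) is a function on $\overline{\mathbb{B}^{n+1}}\times\overline{\mathbb{B}^{n+1}}$ with values in $\mathbb{R}\cup\{\infty\}$ such that: for all $\eta\in\mathbb{B}^{n+1}$, $\xi\mapsto\bar G^{(i,j)}(\xi,\eta)-\Gamma(\xi-\eta)$ is in $C^\infty(\overline{\mathbb{B}^{n+1}})$; $\Delta_\xi^2(\bar G^{(i,j)}(\xi,\eta)-\Gamma(\xi-\eta))=0$ for all $\xi,\eta\in\mathbb{B}^{n+1}$; and $\mathscr{B}^3_i\bar G^{(i,j)}=0$, $\mathscr{B}^3_j\bar G^{(i,j)}=0$ on $\mathbb{S}^n$.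
   Formalization: The link G^(0,2) ≤ G^(1,3) fails for n=2 (there Γ<0) and is never an equality; it is proved as strict < for n>3 and as the reversed strict inequality for n=2, and the equality criterion is claimed only for the other three links. *)

theory Defs
  imports "HOL-Analysis.Analysis"
begin

text \<open>
  Throughout, \<open>n\<close> is the dimension of the sphere; the ambient space \<open>'a\<close> is to be taken with
  \<open>DIM('a) = n + 1\<close>, so that \<open>ball 0 1\<close>, \<open>cball 0 1\<close>, \<open>sphere 0 1\<close> are the open unit ball
  of $\mathbb{R}^{n+1}$, its closure and the unit sphere $\mathbb{S}^n$.
\<close>

subsection \<open>Differential operators\<close>

definition dir_deriv :: "'a::euclidean_space \<Rightarrow> ('a \<Rightarrow> real) \<Rightarrow> 'a \<Rightarrow> real" where
  "dir_deriv v f x = frechet_derivative f (at x) v"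

primrec Ck_on :: "nat \<Rightarrow> ('a::euclidean_space \<Rightarrow> real) \<Rightarrow> 'a set \<Rightarrow> bool" where
  "Ck_on 0 f V = continuous_on V f"
| "Ck_on (Suc k) f V =
     ((\<forall>x\<in>V. f differentiable (at x)) \<and> (\<forall>b\<in>Basis. Ck_on k (dir_deriv b f) V))"

text \<open>For open \<open>V\<close> only.\<close>

definition smooth_on :: "('a::euclidean_space \<Rightarrow> real) \<Rightarrow> 'a set \<Rightarrow> bool" where
  "smooth_on f V \<longleftrightarrow> (\<forall>k. Ck_on k f V)"

definition laplacian :: "('a::euclidean_space \<Rightarrow> real) \<Rightarrow> 'a \<Rightarrow> real" where
  "laplacian f x = (\<Sum>b\<in>Basis. dir_deriv b (dir_deriv b f) x)"

text \<open>\<open>sgn x = x /\<^sub>R norm x\<close> is the unit radial vector.\<close>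

definition radial_deriv :: "('a::euclidean_space \<Rightarrow> real) \<Rightarrow> 'a \<Rightarrow> real" where
  "radial_deriv f x = dir_deriv (sgn x) f x"

text \<open>
  The Laplace--Beltrami operator of the round unit sphere, applied to the restriction of \<open>f\<close> to
  the sphere: the Euclidean Laplacian of the extension that is constant along rays. It is only
  meant to be evaluated at points of the unit sphere.
\<close>

definition sphere_laplacian :: "('a::euclidean_space \<Rightarrow> real) \<Rightarrow> 'a \<Rightarrow> real" where
  "sphere_laplacian f x = laplacian (\<lambda>y. f (sgn y)) x"

subsection \<open>Conformal boundary operators\<close>

definition bdry_op0 :: "nat \<Rightarrow> ('a::euclidean_space \<Rightarrow> real) \<Rightarrow> 'a \<Rightarrow> real" where
  "bdry_op0 n U \<xi> = U \<xi>"

definition bdry_op1 :: "nat \<Rightarrow> ('a::euclidean_space \<Rightarrow> real) \<Rightarrow> 'a \<Rightarrow> real" where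
  "bdry_op1 n U \<xi> = radial_deriv U \<xi> + (real n - 3) / 2 * U \<xi>"

definition bdry_op2 :: "nat \<Rightarrow> ('a::euclidean_space \<Rightarrow> real) \<Rightarrow> 'a \<Rightarrow> real" where
  "bdry_op2 n U \<xi> =
     radial_deriv (radial_deriv U) \<xi> - sphere_laplacian U \<xi>
     + (real n - 2) * radial_deriv U \<xi> + (real n - 3) * (real n - 1) / 2 * U \<xi>"

definition bdry_op3 :: "nat \<Rightarrow> ('a::euclidean_space \<Rightarrow> real) \<Rightarrow> 'a \<Rightarrow> real" where
  "bdry_op3 n U \<xi> =
     - radial_deriv (laplacian U) \<xi> - 2 * sphere_laplacian (radial_deriv U) \<xi>
     - (real n - 3) / 2 * radial_deriv (radial_deriv U) \<xi>
     - (3 * real n - 5) / 2 * sphere_laplacian U \<xi>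
     + (real n - 3) / 2 * radial_deriv U \<xi>
     + ((real n)\<^sup>2 - 1) * (real n - 3) / 4 * U \<xi>"

definition bdry_op :: "nat \<Rightarrow> nat \<Rightarrow> ('a::euclidean_space \<Rightarrow> real) \<Rightarrow> 'a \<Rightarrow> real" where
  "bdry_op n i = [bdry_op0 n, bdry_op1 n, bdry_op2 n, bdry_op3 n] ! i"

subsection \<open>The fundamental solution of the bi-Laplacian\<close>

text \<open>The surface area of the unit sphere is \<open>n + 1\<close> times the volume of the unit ball it bounds.\<close>

definition sphere_area :: "nat \<Rightarrow> real" where
  "sphere_area n = real (n + 1) * unit_ball_vol (real (n + 1))"

text \<open>Positive for \<open>n \<ge> 4\<close>, but negative for \<open>n = 2\<close>.\<close>

definition fund_sol :: "nat \<Rightarrow> real \<Rightarrow> real" where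
  "fund_sol n \<rho> =
     1 / (2 * (real n - 1) * (real n - 3) * sphere_area n) * \<rho> powi (3 - int n)"

text \<open>
  The same with its correct value at \<open>\<rho> = 0\<close>, which is \<open>\<infinity>\<close> for \<open>n > 3\<close>
  (\<open>powi\<close> returns \<open>0\<close> there).
\<close>

definition fund_sol_ext :: "nat \<Rightarrow> real \<Rightarrow> ereal" where
  "fund_sol_ext n \<rho> = (if \<rho> = 0 \<and> n > 3 then \<infinity> else ereal (fund_sol n \<rho>))"

text \<open>The quantity $|\xi|\,|\xi^\ast-\eta|$; the radicand is nonnegative on the closed ball.\<close>

definition refl_dist :: "'a::euclidean_space \<Rightarrow> 'a \<Rightarrow> real" where
  "refl_dist \<xi> \<eta> = sqrt ((norm (\<xi> - \<eta>))\<^sup>2 + (1 - (norm \<xi>)\<^sup>2) * (1 - (norm \<eta>)\<^sup>2))"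

subsection \<open>Green functions\<close>

text \<open>
  Smoothness on the closed ball means having a smooth extension to an open neighbourhood. The
  regular part \<open>H\<close> of \<open>G(\<cdot>, \<eta>)\<close> is taken together with such an extension, so that the boundary
  operators can be computed with ordinary two-sided derivatives. Their values at points of the
  sphere do not depend on the extension: all derivatives of \<open>H\<close> at such points are limits of its
  derivatives from inside the ball. Near the sphere the real function
  \<open>\<lambda>x. fund_sol n (norm (x - \<eta>)) + H x\<close> is the function \<open>G(\<cdot>, \<eta>)\<close>, extended past the sphere.
  Only the values of \<open>G\<close> on the product of two closed balls matter.
\<close>

definition is_green ::
    "nat \<Rightarrow> nat \<Rightarrow> nat \<Rightarrow> ('a::euclidean_space \<Rightarrow> 'a \<Rightarrow> ereal) \<Rightarrow> bool" where
  "is_green n i j G \<longleftrightarrow>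
     i < j \<and> j \<le> 3 \<and> i + j \<noteq> 3 \<and>
     (\<forall>\<xi>\<in>cball 0 1. \<forall>\<eta>\<in>cball 0 1. G \<xi> \<eta> \<noteq> -\<infinity>) \<and>
     (\<forall>\<eta>\<in>ball 0 1. \<exists>V H. open V \<and> cball 0 1 \<subseteq> V \<and> smooth_on H V \<and>
        (\<forall>\<xi>\<in>cball 0 1. G \<xi> \<eta> = fund_sol_ext n (norm (\<xi> - \<eta>)) + ereal (H \<xi>)) \<and>
        (\<forall>\<xi>\<in>ball 0 1. laplacian (laplacian H) \<xi> = 0) \<and>
        (\<forall>\<xi>\<in>sphere 0 1. bdry_op n i (\<lambda>x. fund_sol n (norm (x - \<eta>)) + H x) \<xi> = 0) \<and>
        (\<forall>\<xi>\<in>sphere 0 1. bdry_op n j (\<lambda>x. fund_sol n (norm (x - \<eta>)) + H x) \<xi> = 0))"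

text \<open>
  The explicit kernels, on the product of two closed balls. The only exceptional points are
  \<open>\<xi> = \<eta>\<close> on the sphere, where \<open>refl_dist\<close> vanishes.
\<close>

definition green01 :: "nat \<Rightarrow> 'a::euclidean_space \<Rightarrow> 'a \<Rightarrow> ereal" where
  "green01 n \<xi> \<eta> = fund_sol_ext n (norm (\<xi> - \<eta>))
     + ereal (1 / 2 * fund_sol n (refl_dist \<xi> \<eta>)
         * ((real n - 3) * ((norm (\<xi> - \<eta>))\<^sup>2 / (refl_dist \<xi> \<eta>)\<^sup>2) - (real n - 1)))"

definition green23 :: "nat \<Rightarrow> 'a::euclidean_space \<Rightarrow> 'a \<Rightarrow> ereal" where
  "green23 n \<xi> \<eta> = fund_sol_ext n (norm (\<xi> - \<eta>))
     - ereal (1 / 2 * fund_sol n (refl_dist \<xi> \<eta>)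
         * ((real n - 3) * ((norm (\<xi> - \<eta>))\<^sup>2 / (refl_dist \<xi> \<eta>)\<^sup>2) - (real n - 1)))"

definition green02 :: "nat \<Rightarrow> 'a::euclidean_space \<Rightarrow> 'a \<Rightarrow> ereal" where
  "green02 n \<xi> \<eta> = fund_sol_ext n (norm (\<xi> - \<eta>)) - ereal (fund_sol n (refl_dist \<xi> \<eta>))"

definition green13 :: "nat \<Rightarrow> 'a::euclidean_space \<Rightarrow> 'a \<Rightarrow> ereal" where
  "green13 n \<xi> \<eta> = fund_sol_ext n (norm (\<xi> - \<eta>)) + ereal (fund_sol n (refl_dist \<xi> \<eta>))"

end

theory Submission
  imports Defs
begin

text \<open>
  Write \<open>E = x \<bullet> \<nabla>\<close>, \<open>w = \<Delta>U\<close> and \<open>V = (1 - |x|\<^sup>2) w + 4 E U + 2 (n - 3) U\<close>. On the unit sphere every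
  smooth \<open>U\<close> satisfies \<open>B\<^sub>1 U = V / 4\<close>, \<open>B\<^sub>2 U = (E + (n - 1) / 2) V / 2\<close> and
  \<open>B\<^sub>3 U = (E + (n - 1) / 2) ((E + (n + 1) / 2) V / 2 - w)\<close>, and \<open>V\<close> and \<open>w\<close> are harmonic when \<open>U\<close>
  is biharmonic.

  Uniqueness: \<open>E f + a f\<close> is harmonic whenever \<open>f\<close> is, so by the maximum principle either of
  \<open>B\<^sub>1 U = 0\<close>, \<open>B\<^sub>2 U = 0\<close> forces \<open>V = 0\<close>; then \<open>U = 0\<close> on the sphere forces \<open>w = 0\<close> there, because the
  radial derivative of \<open>V\<close> vanishes, and \<open>B\<^sub>3 U = 0\<close> becomes \<open>(E + (n - 1) / 2) w = 0\<close>. In both cases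
  \<open>w = 0\<close>, and \<open>U\<close> is harmonic with a homogeneous Dirichlet or Robin condition. For \<open>n = 2\<close> the Robin
  coefficient \<open>(n - 3) / 2\<close> is negative, but the partial derivatives of \<open>U\<close> satisfy the Robin condition
  with coefficient \<open>1 / 2\<close>.

  Existence: with \<open>P = |\<xi> - \<eta>| powr (1 - n)\<close> and its Kelvin transform \<open>Q\<close>, the functions \<open>V\<close> and
  \<open>w\<close> of the kernels are combinations of \<open>P\<close>, \<open>Q\<close> and \<open>E Q\<close>, and \<open>D = E + (n - 1) / 2\<close> satisfies
  \<open>D P = - D Q\<close> and \<open>D (D P) = D (D Q)\<close> on the sphere.

  The order of the kernels is convexity: up to the factor of the fundamental solution, the first
  kernel is the gap between \<open>t powr ((3 - n) / 2)\<close> and its tangent.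
\<close>

subsection \<open>Directional derivatives and smooth functions\<close>

lemma dir_deriv_unique:
  assumes "(f has_derivative f') (at x)"
  shows "dir_deriv v f x = f' v"
  unfolding dir_deriv_def using frechet_derivative_at[OF assms] by simp

lemma has_derivative_dir_deriv:
  assumes "f differentiable (at x)"
  shows "(f has_derivative (\<lambda>v. dir_deriv v f x)) (at x)"
  using assms unfolding dir_deriv_def frechet_derivative_works by simp

text \<open>\<open>frechet_derivative\<close> is a choice among the derivatives at the point. Two
  functions that agree near the point have the same derivatives there, so the choices coincide even
  if there is none to choose from.\<close>

lemma dir_deriv_cong:
  assumes "open V" "x \<in> V" "\<And>y. y \<in> V \<Longrightarrow> f y = g y"
  shows "dir_deriv v f x = dir_deriv v g x"
proof -
  have "(f has_derivative f') (at x) \<longleftrightarrow> (g has_derivative f') (at x)" for f'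
  proof
    assume "(f has_derivative f') (at x)"
    from has_derivative_transform_within_open[OF this assms] show "(g has_derivative f') (at x)" .
  next
    assume "(g has_derivative f') (at x)"
    from has_derivative_transform_within_open[OF this assms(1,2) assms(3)[symmetric]]
    show "(f has_derivative f') (at x)" .
  qed
  then show ?thesis
    by (simp add: dir_deriv_def frechet_derivative_def)
qed

lemma differentiable_cong_open:
  assumes "open V" "x \<in> V" "\<And>y. y \<in> V \<Longrightarrow> f y = g y" "f differentiable (at x)"
  shows "g differentiable (at x)"
proof -
  obtain f' where "(f has_derivative f') (at x)"
    using assms(4) by (auto simp: differentiable_def)
  from has_derivative_transform_within_open[OF this assms(1-3)] show ?thesis
    by (auto simp: differentiable_def)
qed

lemma dir_deriv_const [simp]: "dir_deriv v (\<lambda>x. c) x = 0"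
  by (rule dir_deriv_unique) (rule has_derivative_const)

lemma dir_deriv_add:
  assumes "f differentiable (at x)" "g differentiable (at x)"
  shows "dir_deriv v (\<lambda>x. f x + g x) x = dir_deriv v f x + dir_deriv v g x"
  using dir_deriv_unique[OF has_derivative_add[OF assms[THEN has_derivative_dir_deriv]]] .

lemma dir_deriv_mult:
  assumes "f differentiable (at x)" "g differentiable (at x)"
  shows "dir_deriv v (\<lambda>x. f x * g x) x = f x * dir_deriv v g x + dir_deriv v f x * g x"
  using dir_deriv_unique[OF has_derivative_mult[OF assms[THEN has_derivative_dir_deriv]]] .

lemma dir_deriv_powr:
  assumes "f differentiable (at x)" "f x > 0"
  shows "dir_deriv v (\<lambda>x. f x powr p) x = p * f x powr (p - 1) * dir_deriv v f x"
proof (rule dir_deriv_unique)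
  show "((\<lambda>x. f x powr p) has_derivative (\<lambda>v. p * f x powr (p - 1) * dir_deriv v f x)) (at x)"
    using assms(2)
    by (auto intro!: derivative_eq_intros has_derivative_dir_deriv[OF assms(1)]
        simp: powr_diff fun_eq_iff)
qed

lemma dir_deriv_linear:
  assumes "f differentiable (at x)"
  shows "linear (\<lambda>v. dir_deriv v f x)"
  using has_derivative_linear[OF has_derivative_dir_deriv[OF assms]] .

lemma dir_deriv_expand:
  fixes f :: "'a::euclidean_space \<Rightarrow> real"
  assumes "f differentiable (at x)"
  shows "dir_deriv v f x = (\<Sum>b\<in>Basis. (v \<bullet> b) * dir_deriv b f x)"
proof -
  have "dir_deriv (\<Sum>b\<in>Basis. (v \<bullet> b) *\<^sub>R b) f x = (\<Sum>b\<in>Basis. (v \<bullet> b) * dir_deriv b f x)"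
    unfolding linear_sum[OF dir_deriv_linear[OF assms]] linear_scale[OF dir_deriv_linear[OF assms]]
    by simp
  then show ?thesis by (simp add: euclidean_representation)
qed

section \<open>Closure properties of C^k and smooth functions\<close>

lemma Ck_on_cong:
  assumes "open V" "\<And>x. x \<in> V \<Longrightarrow> f x = g x"
  shows "Ck_on k f V \<longleftrightarrow> Ck_on k g V"
  using assms(2)
proof (induction k arbitrary: f g)
  case 0
  then show ?case using continuous_on_cong[of V V f g] by simp
next
  case (Suc k)
  have "Ck_on k (dir_deriv b f) V \<longleftrightarrow> Ck_on k (dir_deriv b g) V" for b
    by (rule Suc.IH) (rule dir_deriv_cong[OF assms(1) _ Suc.prems])
  moreover have "f differentiable (at x) \<longleftrightarrow> g differentiable (at x)" if "x \<in> V" for x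
    using differentiable_cong_open[of V x f g] differentiable_cong_open[of V x g f]
      assms(1) that Suc.prems by auto
  ultimately show ?case by simp
qed

lemma Ck_on_SucD: "Ck_on (Suc k) f V \<Longrightarrow> Ck_on k f V"
proof (induction k arbitrary: f)
  case 0
  then have "f differentiable (at x)" if "x \<in> V" for x using that by simp
  then show ?case
    by (simp add: continuous_at_imp_continuous_on differentiable_imp_continuous_within)
next
  case (Suc k)
  have "\<forall>b\<in>Basis. Ck_on (Suc k) (dir_deriv b f) V" "\<forall>x\<in>V. f differentiable (at x)"
    using Suc.prems unfolding Ck_on.simps(2)[of "Suc k"] by blast+
  then show ?case unfolding Ck_on.simps(2)[of k f] using Suc.IH by blast
qed

lemma Ck_on_subset: "Ck_on k f V \<Longrightarrow> W \<subseteq> V \<Longrightarrow> Ck_on k f W"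
  by (induction k arbitrary: f) (auto intro: continuous_on_subset)

lemma Ck_on_const: "Ck_on k (\<lambda>x. c) V"
proof (induction k arbitrary: c)
  case (Suc k)
  then show ?case by (simp add: fun_eq_iff dir_deriv_const[abs_def])
qed simp

lemma Ck_on_add:
  assumes "open V"
  shows "Ck_on k f V \<Longrightarrow> Ck_on k g V \<Longrightarrow> Ck_on k (\<lambda>x. f x + g x) V"
proof (induction k arbitrary: f g)
  case 0
  then show ?case by (simp add: continuous_on_add)
next
  case (Suc k)
  have "Ck_on k (dir_deriv b (\<lambda>x. f x + g x)) V" if "b \<in> Basis" for b
  proof -
    have "Ck_on k (\<lambda>x. dir_deriv b f x + dir_deriv b g x) V"
      using Suc that by simp
    then show ?thesis
      using Ck_on_cong[OF assms, of "dir_deriv b (\<lambda>x. f x + g x)"] Suc.prems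
      by (simp add: dir_deriv_add)
  qed
  then show ?case using Suc.prems by simp
qed

lemma Ck_on_mult:
  assumes "open V"
  shows "Ck_on k f V \<Longrightarrow> Ck_on k g V \<Longrightarrow> Ck_on k (\<lambda>x. f x * g x) V"
proof (induction k arbitrary: f g)
  case 0
  then show ?case by (simp add: continuous_on_mult)
next
  case (Suc k)
  have "Ck_on k (dir_deriv b (\<lambda>x. f x * g x)) V" if "b \<in> Basis" for b
  proof -
    have "Ck_on k (\<lambda>x. f x * dir_deriv b g x + dir_deriv b f x * g x) V"
      using Suc that Ck_on_SucD[OF Suc.prems(1)] Ck_on_SucD[OF Suc.prems(2)]
      by (intro Ck_on_add[OF assms] Suc.IH) auto
    then show ?thesis
      using Ck_on_cong[OF assms, of "dir_deriv b (\<lambda>x. f x * g x)"] Suc.prems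
      by (simp add: dir_deriv_mult)
  qed
  then show ?case using Suc.prems by simp
qed

text \<open>Chain rule, with the exponent varying in the induction, because the derivative contains
  the power with exponent \<open>p - 1\<close>.\<close>

lemma Ck_on_powr:
  assumes "open V" "\<And>x. x \<in> V \<Longrightarrow> f x > 0"
  shows "Ck_on k f V \<Longrightarrow> Ck_on k (\<lambda>x. f x powr p) V"
proof (induction k arbitrary: p)
  case 0
  then show ?case using assms(2) by (force intro!: continuous_on_powr)
next
  case (Suc k)
  have "Ck_on k (dir_deriv b (\<lambda>x. f x powr p)) V" if "b \<in> Basis" for b
  proof -
    have "Ck_on k (\<lambda>x. p * f x powr (p - 1) * dir_deriv b f x) V"
      using Suc.prems that Suc.IH[OF Ck_on_SucD[OF Suc.prems(1)]]
      by (intro Ck_on_mult[OF assms(1)] Ck_on_const) auto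
    then show ?thesis
      using Ck_on_cong[OF assms(1), of "dir_deriv b (\<lambda>x. f x powr p)"] Suc.prems assms(2)
      by (simp add: dir_deriv_powr)
  qed
  moreover have "(\<lambda>x. f x powr p) differentiable (at x)" if x: "x \<in> V" for x
  proof -
    have "f differentiable (at x)" using Suc.prems x by simp
    from has_derivative_powr[OF has_derivative_dir_deriv[OF this] has_derivative_const[of p]]
    show ?thesis using assms(2)[OF x] by (auto simp: differentiable_def)
  qed
  ultimately show ?case by simp
qed

lemma smooth_on_imp_continuous_on: "smooth_on f V \<Longrightarrow> continuous_on V f"
  unfolding smooth_on_def by (drule spec[of _ 0]) simp

lemma smooth_on_imp_differentiable: "smooth_on f V \<Longrightarrow> x \<in> V \<Longrightarrow> f differentiable (at x)"
  unfolding smooth_on_def by (drule spec[of _ "Suc 0"]) simp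

lemma smooth_on_cong:
  "open V \<Longrightarrow> (\<And>x. x \<in> V \<Longrightarrow> f x = g x) \<Longrightarrow> smooth_on f V \<longleftrightarrow> smooth_on g V"
  using Ck_on_cong[of V f g] by (auto simp: smooth_on_def)

lemma smooth_on_subset: "smooth_on f V \<Longrightarrow> W \<subseteq> V \<Longrightarrow> smooth_on f W"
  by (auto simp: smooth_on_def intro: Ck_on_subset)

lemma smooth_on_const: "smooth_on (\<lambda>x. c) V"
  by (simp add: smooth_on_def Ck_on_const)

lemma smooth_on_add:
  "open V \<Longrightarrow> smooth_on f V \<Longrightarrow> smooth_on g V \<Longrightarrow> smooth_on (\<lambda>x. f x + g x) V"
  by (simp add: smooth_on_def Ck_on_add)

lemma smooth_on_mult:
  "open V \<Longrightarrow> smooth_on f V \<Longrightarrow> smooth_on g V \<Longrightarrow> smooth_on (\<lambda>x. f x * g x) V"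
  by (simp add: smooth_on_def Ck_on_mult)

lemma smooth_on_uminus:
  "open V \<Longrightarrow> smooth_on f V \<Longrightarrow> smooth_on (\<lambda>x. - f x) V"
  using smooth_on_mult[OF _ smooth_on_const[of "-1"], of V f] by simp

lemma smooth_on_diff:
  "open V \<Longrightarrow> smooth_on f V \<Longrightarrow> smooth_on g V \<Longrightarrow> smooth_on (\<lambda>x. f x - g x) V"
  using smooth_on_add[OF _ _ smooth_on_uminus, of V f g] by simp

lemma smooth_on_powr:
  "open V \<Longrightarrow> (\<And>x. x \<in> V \<Longrightarrow> f x > 0) \<Longrightarrow> smooth_on f V \<Longrightarrow> smooth_on (\<lambda>x. f x powr p) V"
  by (simp add: smooth_on_def Ck_on_powr)

lemma smooth_on_sum:
  assumes "open V" "\<And>i. i \<in> I \<Longrightarrow> smooth_on (f i) V"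
  shows "smooth_on (\<lambda>x. \<Sum>i\<in>I. f i x) V"
  using assms(2)
  by (induction I rule: infinite_finite_induct)
    (auto intro!: smooth_on_add[OF assms(1)] smooth_on_const)

lemma smooth_on_dir_deriv_Basis: "smooth_on f V \<Longrightarrow> b \<in> Basis \<Longrightarrow> smooth_on (dir_deriv b f) V"
  unfolding smooth_on_def
proof
  fix k
  assume "\<forall>k. Ck_on k f V" "b \<in> Basis"
  from this(1)[THEN spec, of "Suc k"] this(2) show "Ck_on k (dir_deriv b f) V" by simp
qed

lemma smooth_on_inner_left: "smooth_on (\<lambda>x. x \<bullet> a) V"
  unfolding smooth_on_def
proof
  fix k
  have D: "((\<lambda>x. x \<bullet> a) has_derivative (\<lambda>v. v \<bullet> a)) (at x)" for x :: 'a
    by (auto intro!: derivative_eq_intros)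
  have eq: "dir_deriv b (\<lambda>x. x \<bullet> a) = (\<lambda>x. b \<bullet> a)" for b
    using dir_deriv_unique[OF D] by auto
  have d: "(\<lambda>x. x \<bullet> a) differentiable (at x)" for x
    using D by (auto simp: differentiable_def)
  show "Ck_on k (\<lambda>x. x \<bullet> a) V"
  proof (cases k)
    case 0
    then show ?thesis by (auto intro!: continuous_intros)
  next
    case (Suc j)
    show ?thesis unfolding Suc Ck_on.simps eq using d Ck_on_const by blast
  qed
qed

lemma smooth_on_inner_self: "open V \<Longrightarrow> smooth_on (\<lambda>x. x \<bullet> x) V"
  by (subst euclidean_inner) (intro smooth_on_sum smooth_on_mult smooth_on_inner_left)

text \<open>\<open>Ck_on\<close> speaks of basis directions only. A derivative in another direction
  is a combination of these with constant coefficients.\<close>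

lemma smooth_on_dir_deriv:
  assumes "open V" "smooth_on f V"
  shows "smooth_on (dir_deriv v f) V"
proof -
  have "smooth_on (\<lambda>x. \<Sum>b\<in>Basis. (v \<bullet> b) * dir_deriv b f x) V"
    using assms by (intro smooth_on_sum smooth_on_mult smooth_on_const smooth_on_dir_deriv_Basis)
  then show ?thesis
    using smooth_on_cong[OF assms(1), of "dir_deriv v f" "\<lambda>x. \<Sum>b\<in>Basis. (v \<bullet> b) * dir_deriv b f x"]
      dir_deriv_expand[OF smooth_on_imp_differentiable[OF assms(2)]] by simp
qed

lemma smooth_on_laplacian:
  assumes "open V" "smooth_on f V"
  shows "smooth_on (laplacian f) V"
  unfolding laplacian_def [abs_def] using assms by (intro smooth_on_sum smooth_on_dir_deriv)

section \<open>Symmetry of second derivatives\<close>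

lemma has_real_derivative_along_line:
  assumes "f differentiable (at (x + t *\<^sub>R v))"
  shows "((\<lambda>t. f (x + t *\<^sub>R v)) has_real_derivative dir_deriv v f (x + t *\<^sub>R v)) (at t)"
proof -
  have "((\<lambda>t. x + t *\<^sub>R v) has_derivative (\<lambda>h. h *\<^sub>R v)) (at t)"
    by (auto intro!: derivative_eq_intros)
  from has_derivative_compose[OF this has_derivative_dir_deriv[OF assms]]
  have "((\<lambda>t. f (x + t *\<^sub>R v)) has_derivative (\<lambda>h. dir_deriv (h *\<^sub>R v) f (x + t *\<^sub>R v))) (at t)" .
  then show ?thesis
    using linear_scale[OF dir_deriv_linear[OF assms]]
    unfolding has_field_derivative_def
    by (auto elim!: has_derivative_eq_rhs simp: fun_eq_iff)
qed

text \<open>The mean value theorem is applied twice: to the difference in direction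
  \<open>b\<close>, as a function of the step along \<open>a\<close>, and then to
  \<open>dir_deriv a f\<close> along \<open>b\<close>.\<close>

lemma second_difference_mean_value:
  fixes f :: "'a::euclidean_space \<Rightarrow> real"
  assumes f: "open V" "smooth_on f V" and h: "h > 0"
    and sub: "\<And>s t. s \<in> {0..h} \<Longrightarrow> t \<in> {0..h} \<Longrightarrow> x + s *\<^sub>R a + t *\<^sub>R b \<in> V"
  obtains s t where "s \<in> {0..h}" "t \<in> {0..h}"
    "f (x + h *\<^sub>R a + h *\<^sub>R b) - f (x + h *\<^sub>R a) - f (x + h *\<^sub>R b) + f x
       = h\<^sup>2 * dir_deriv b (dir_deriv a f) (x + s *\<^sub>R a + t *\<^sub>R b)"
proof -
  define \<phi> where "\<phi> = (\<lambda>s. f ((x + h *\<^sub>R b) + s *\<^sub>R a) - f (x + s *\<^sub>R a))"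
  define \<phi>' where "\<phi>' = (\<lambda>s. dir_deriv a f ((x + h *\<^sub>R b) + s *\<^sub>R a) - dir_deriv a f (x + s *\<^sub>R a))"
  have "(\<phi> has_real_derivative \<phi>' s) (at s)" if "0 \<le> s" "s \<le> h" for s
  proof -
    have "x + s *\<^sub>R a + h *\<^sub>R b \<in> V" "x + s *\<^sub>R a + 0 *\<^sub>R b \<in> V"
      using sub[of s h] sub[of s 0] that h by auto
    then show ?thesis
      unfolding \<phi>_def \<phi>'_def
      by (intro DERIV_diff has_real_derivative_along_line[where v = a]
          smooth_on_imp_differentiable[OF f(2)]) (simp_all add: algebra_simps)
  qed
  from MVT2[OF h this] obtain s where s: "0 < s" "s < h" "\<phi> h - \<phi> 0 = h * \<phi>' s"
    by auto
  define \<psi> where "\<psi> = (\<lambda>t. dir_deriv a f ((x + s *\<^sub>R a) + t *\<^sub>R b))"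
  have "(\<psi> has_real_derivative dir_deriv b (dir_deriv a f) (x + s *\<^sub>R a + t *\<^sub>R b)) (at t)"
    if "0 \<le> t" "t \<le> h" for t
    unfolding \<psi>_def using sub[of s t] that s
    by (intro has_real_derivative_along_line
        smooth_on_imp_differentiable[OF smooth_on_dir_deriv[OF f]]) auto
  from MVT2[OF h this] obtain t where t: "0 < t" "t < h"
    "\<psi> h - \<psi> 0 = h * dir_deriv b (dir_deriv a f) (x + s *\<^sub>R a + t *\<^sub>R b)"
    by auto
  have "\<psi> h - \<psi> 0 = \<phi>' s"
    by (simp add: \<psi>_def \<phi>'_def algebra_simps)
  moreover have "\<phi> h - \<phi> 0
      = f (x + h *\<^sub>R a + h *\<^sub>R b) - f (x + h *\<^sub>R a) - f (x + h *\<^sub>R b) + f x"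
    by (simp add: \<phi>_def algebra_simps)
  ultimately have "f (x + h *\<^sub>R a + h *\<^sub>R b) - f (x + h *\<^sub>R a) - f (x + h *\<^sub>R b) + f x
       = h\<^sup>2 * dir_deriv b (dir_deriv a f) (x + s *\<^sub>R a + t *\<^sub>R b)"
    using s(3) t(3) by (simp add: power2_eq_square mult.assoc)
  then show ?thesis
    using s t by (intro that[of s t]) auto
qed

text \<open>Schwarz's theorem. The second difference is symmetric in \<open>a\<close> and
  \<open>b\<close>, so both mixed derivatives take a common value at points arbitrarily close to
  \<open>x\<close>. By continuity they cannot differ at \<open>x\<close>.\<close>

lemma dir_deriv_commute:
  fixes f :: "'a::euclidean_space \<Rightarrow> real"
  assumes f: "open V" "smooth_on f V" and x: "x \<in> V"
  shows "dir_deriv a (dir_deriv b f) x = dir_deriv b (dir_deriv a f) x"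
proof (rule ccontr)
  define F where "F = dir_deriv a (dir_deriv b f)"
  define G where "G = dir_deriv b (dir_deriv a f)"
  assume "dir_deriv a (dir_deriv b f) x \<noteq> dir_deriv b (dir_deriv a f) x"
  then have e: "\<bar>F x - G x\<bar> / 2 > 0" (is "?e > 0") by (simp add: F_def G_def)
  have cont: "isCont F x" "isCont G x"
    unfolding F_def G_def using x continuous_on_eq_continuous_at[OF f(1)]
      smooth_on_imp_continuous_on[OF smooth_on_dir_deriv[OF f(1) smooth_on_dir_deriv[OF f]]]
    by auto
  obtain d1 where d1: "d1 > 0" "\<And>y. dist y x < d1 \<Longrightarrow> \<bar>F y - F x\<bar> < ?e"
    using cont(1)[unfolded continuous_at_eps_delta, rule_format, OF e]
    by (auto simp: dist_real_def dist_commute)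
  obtain d2 where d2: "d2 > 0" "\<And>y. dist y x < d2 \<Longrightarrow> \<bar>G y - G x\<bar> < ?e"
    using cont(2)[unfolded continuous_at_eps_delta, rule_format, OF e]
    by (auto simp: dist_real_def dist_commute)
  obtain d3 where d3: "d3 > 0" "ball x d3 \<subseteq> V"
    using f(1) x open_contains_ball by blast
  define d where "d = min d1 (min d2 d3)"
  define M where "M = norm a + norm b + 1"
  \<comment> \<open>With this step the parallelogram spanned by \<open>h *\<^sub>R a\<close> and
    \<open>h *\<^sub>R b\<close> at \<open>x\<close> stays within distance \<open>d / 2\<close> of
    \<open>x\<close>. The summand 1 in \<open>M\<close> keeps the denominator positive when
    \<open>a\<close> and \<open>b\<close> vanish.\<close>
  define h where "h = d / (2 * M)"
  have d: "d > 0" using d1 d2 d3 by (simp add: d_def)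
  have M: "M > 0" by (simp add: M_def add_nonneg_pos)
  have h: "h > 0" using d M by (simp add: h_def)
  have close: "dist (x + s *\<^sub>R a + t *\<^sub>R b) x < d" if "s \<in> {0..h}" "t \<in> {0..h}" for s t
  proof -
    have "norm (s *\<^sub>R a + t *\<^sub>R b) \<le> s * norm a + t * norm b"
      using norm_triangle_ineq[of "s *\<^sub>R a" "t *\<^sub>R b"] that by simp
    also have "\<dots> \<le> h * norm a + h * norm b"
      using that by (intro add_mono mult_right_mono) auto
    also have "\<dots> \<le> h * M"
      using h by (simp add: M_def algebra_simps)
    also have "\<dots> = d / 2" using M by (simp add: h_def)
    finally show ?thesis using d by (simp add: dist_norm)
  qed
  have inV: "x + s *\<^sub>R a + t *\<^sub>R b \<in> V" if "s \<in> {0..h}" "t \<in> {0..h}" for s t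
    using close[OF that] d3(2) by (auto simp: d_def dist_commute)
  have inV': "x + t *\<^sub>R b + s *\<^sub>R a \<in> V" if "t \<in> {0..h}" "s \<in> {0..h}" for s t
    using inV[OF that(2,1)] by (simp add: algebra_simps)
  obtain s t where st: "s \<in> {0..h}" "t \<in> {0..h}"
    "f (x + h *\<^sub>R a + h *\<^sub>R b) - f (x + h *\<^sub>R a) - f (x + h *\<^sub>R b) + f x
       = h\<^sup>2 * G (x + s *\<^sub>R a + t *\<^sub>R b)"
    using second_difference_mean_value[OF f h inV] unfolding G_def by metis
  obtain t' s' where ts: "t' \<in> {0..h}" "s' \<in> {0..h}"
    "f (x + h *\<^sub>R b + h *\<^sub>R a) - f (x + h *\<^sub>R b) - f (x + h *\<^sub>R a) + f x
       = h\<^sup>2 * F (x + t' *\<^sub>R b + s' *\<^sub>R a)"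
    using second_difference_mean_value[OF f h inV'] unfolding F_def by metis
  have "h\<^sup>2 * G (x + s *\<^sub>R a + t *\<^sub>R b) = h\<^sup>2 * F (x + s' *\<^sub>R a + t' *\<^sub>R b)"
    using st(3) ts(3) by (simp add: algebra_simps)
  then have eq: "G (x + s *\<^sub>R a + t *\<^sub>R b) = F (x + s' *\<^sub>R a + t' *\<^sub>R b)"
    using h by simp
  have "\<bar>F (x + s' *\<^sub>R a + t' *\<^sub>R b) - F x\<bar> < ?e"
    using d1(2) close[OF ts(2,1)] by (simp add: d_def)
  moreover have "\<bar>G (x + s *\<^sub>R a + t *\<^sub>R b) - G x\<bar> < ?e"
    using d2(2) close[OF st(1,2)] by (simp add: d_def)
  ultimately show False using eq by argo
qed

lemmas smooth_intros = smooth_on_const smooth_on_add smooth_on_diff smooth_on_mult smooth_on_sum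
  smooth_on_inner_left smooth_on_inner_self smooth_on_dir_deriv smooth_on_laplacian

lemma dir_deriv_cmult:
  assumes "f differentiable (at x)"
  shows "dir_deriv v (\<lambda>x. c * f x) x = c * dir_deriv v f x"
  using dir_deriv_mult[of "\<lambda>x. c" x f v] assms by simp

lemma dir_deriv_sum:
  assumes "\<And>i. i \<in> I \<Longrightarrow> f i differentiable (at x)"
  shows "dir_deriv v (\<lambda>x. \<Sum>i\<in>I. f i x) x = (\<Sum>i\<in>I. dir_deriv v (f i) x)"
  using dir_deriv_unique[OF has_derivative_sum[OF has_derivative_dir_deriv[OF assms]]] .

lemma dir_deriv_inner_left [simp]: "dir_deriv v (\<lambda>x. x \<bullet> a) x = v \<bullet> a"
  by (rule dir_deriv_unique) (auto intro!: derivative_eq_intros)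

lemma dir_deriv_inner_self [simp]: "dir_deriv v (\<lambda>x. x \<bullet> x) x = 2 * (x \<bullet> v)"
  by (rule dir_deriv_unique) (auto intro!: derivative_eq_intros simp: inner_commute)

section \<open>The Euler operator\<close>

text \<open>The operator E of the introduction, |x| times the radial derivative. Its coefficients
  are linear in x, so in contrast to \<open>radial_deriv\<close> it preserves smoothness across the
  origin.\<close>

definition euler :: "('a::euclidean_space \<Rightarrow> real) \<Rightarrow> 'a \<Rightarrow> real" where
  "euler f x = dir_deriv x f x"

lemma euler_cong:
  assumes "open V" "x \<in> V" "\<And>y. y \<in> V \<Longrightarrow> f y = g y"
  shows "euler f x = euler g x"
  unfolding euler_def using dir_deriv_cong[OF assms] .

lemma euler_expand:
  "f differentiable (at x) \<Longrightarrow> euler f x = (\<Sum>b\<in>Basis. (x \<bullet> b) * dir_deriv b f x)"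
  unfolding euler_def by (rule dir_deriv_expand)

lemma euler_const [simp]: "euler (\<lambda>x. c) x = 0"
  by (simp add: euler_def)

lemma euler_add:
  "f differentiable (at x) \<Longrightarrow> g differentiable (at x)
    \<Longrightarrow> euler (\<lambda>x. f x + g x) x = euler f x + euler g x"
  by (simp add: euler_def dir_deriv_add)

lemma euler_mult:
  "f differentiable (at x) \<Longrightarrow> g differentiable (at x)
    \<Longrightarrow> euler (\<lambda>x. f x * g x) x = f x * euler g x + euler f x * g x"
  by (simp add: euler_def dir_deriv_mult)

lemma euler_cmult:
  "f differentiable (at x) \<Longrightarrow> euler (\<lambda>x. c * f x) x = c * euler f x"
  by (simp add: euler_def dir_deriv_cmult)

lemma euler_powr:
  "f differentiable (at x) \<Longrightarrow> f x > 0
    \<Longrightarrow> euler (\<lambda>x. f x powr p) x = p * f x powr (p - 1) * euler f x"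
  by (simp add: euler_def dir_deriv_powr)

lemma smooth_on_euler:
  assumes "open V" "smooth_on f V"
  shows "smooth_on (euler f) V"
proof -
  have "smooth_on (\<lambda>x. \<Sum>b\<in>Basis. (x \<bullet> b) * dir_deriv b f x) V"
    using assms by (intro smooth_intros)
  then show ?thesis
    using smooth_on_cong[OF assms(1), of "euler f" "\<lambda>x. \<Sum>b\<in>Basis. (x \<bullet> b) * dir_deriv b f x"]
      euler_expand[OF smooth_on_imp_differentiable[OF assms(2)]] by simp
qed

text \<open>The commutator of a directional derivative with E is that derivative itself. The extra
  term comes from differentiating the coefficients \<open>x \<bullet> b\<close>; the others are
  rearranged by the symmetry of second derivatives.\<close>

lemma dir_deriv_euler:
  fixes f :: "'a::euclidean_space \<Rightarrow> real"
  assumes V: "open V" "smooth_on f V" "x \<in> V"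
  shows "dir_deriv v (euler f) x = dir_deriv v f x + euler (dir_deriv v f) x"
proof -
  have f: "f differentiable (at y)" "dir_deriv u f differentiable (at y)" if "y \<in> V" for y u
    using V that by (auto intro!: smooth_on_imp_differentiable[where V = V] smooth_intros smooth_on_euler)
  have "dir_deriv v (euler f) x = dir_deriv v (\<lambda>x. \<Sum>b\<in>Basis. (x \<bullet> b) * dir_deriv b f x) x"
    using f by (intro dir_deriv_cong[OF V(1,3)] euler_expand) auto
  also have "\<dots> = (\<Sum>b\<in>Basis. (x \<bullet> b) * dir_deriv v (dir_deriv b f) x + (v \<bullet> b) * dir_deriv b f x)"
  proof -
    have l: "(\<lambda>x. x \<bullet> b) differentiable (at x)" for b
      using smooth_on_imp_differentiable[OF smooth_on_inner_left UNIV_I] .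
    have "(\<lambda>x. (x \<bullet> b) * dir_deriv b f x) differentiable (at x)" for b
      using differentiable_mult[OF l f(2)[OF V(3)]] .
    then have "dir_deriv v (\<lambda>x. \<Sum>b\<in>Basis. (x \<bullet> b) * dir_deriv b f x) x
        = (\<Sum>b\<in>Basis. dir_deriv v (\<lambda>x. (x \<bullet> b) * dir_deriv b f x) x)"
      by (rule dir_deriv_sum)
    then show ?thesis
      unfolding dir_deriv_mult[OF l f(2)[OF V(3)]] dir_deriv_inner_left .
  qed
  also have "\<dots> = (\<Sum>b\<in>Basis. (x \<bullet> b) * dir_deriv b (dir_deriv v f) x)
      + (\<Sum>b\<in>Basis. (v \<bullet> b) * dir_deriv b f x)"
    by (simp add: sum.distrib dir_deriv_commute[OF V, of v])
  also have "\<dots> = euler (dir_deriv v f) x + dir_deriv v f x"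
    using euler_expand[OF f(2)[OF V(3), of v]] dir_deriv_expand[OF f(1)[OF V(3)], of v] by linarith
  finally show ?thesis by simp
qed

section \<open>The Laplacian: product rules, powers and the commutator with the Euler
  operator\<close>

lemma laplacian_cong:
  assumes "open V" "x \<in> V" "\<And>y. y \<in> V \<Longrightarrow> f y = g y"
  shows "laplacian f x = laplacian g x"
  unfolding laplacian_def
  by (intro sum.cong refl dir_deriv_cong[OF assms(1,2)]) (rule dir_deriv_cong[OF assms(1) _ assms(3)])

lemma laplacian_const [simp]: "laplacian (\<lambda>x. c) x = 0"
  by (simp add: laplacian_def dir_deriv_const[abs_def])

lemma laplacian_add:
  assumes V: "open V" "smooth_on f V" "smooth_on g V" "x \<in> V"
  shows "laplacian (\<lambda>x. f x + g x) x = laplacian f x + laplacian g x"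
proof -
  have "dir_deriv b (dir_deriv b (\<lambda>x. f x + g x)) x
      = dir_deriv b (dir_deriv b f) x + dir_deriv b (dir_deriv b g) x" for b
  proof -
    have "dir_deriv b (dir_deriv b (\<lambda>x. f x + g x)) x
        = dir_deriv b (\<lambda>x. dir_deriv b f x + dir_deriv b g x) x"
      using V(2,3)[THEN smooth_on_imp_differentiable] by (intro dir_deriv_cong[OF V(1,4)] dir_deriv_add)
    also have "\<dots> = dir_deriv b (dir_deriv b f) x + dir_deriv b (dir_deriv b g) x"
      using V by (intro dir_deriv_add) (auto intro!: smooth_on_imp_differentiable[where V = V] smooth_intros)
    finally show ?thesis .
  qed
  then show ?thesis by (simp add: laplacian_def sum.distrib)
qed

lemma laplacian_mult:
  assumes V: "open V" "smooth_on f V" "smooth_on g V" "x \<in> V"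
  shows "laplacian (\<lambda>x. f x * g x) x = f x * laplacian g x
    + 2 * (\<Sum>b\<in>Basis. dir_deriv b f x * dir_deriv b g x) + laplacian f x * g x"
proof -
  have d: "f differentiable (at y)" "g differentiable (at y)"
    "dir_deriv b f differentiable (at y)" "dir_deriv b g differentiable (at y)"
    if "y \<in> V" for b y
    using V that by (auto intro!: smooth_on_imp_differentiable[where V = V] smooth_intros smooth_on_euler)
  have "dir_deriv b (dir_deriv b (\<lambda>x. f x * g x)) x
      = f x * dir_deriv b (dir_deriv b g) x + 2 * (dir_deriv b f x * dir_deriv b g x)
        + dir_deriv b (dir_deriv b f) x * g x" for b
  proof -
    have "dir_deriv b (dir_deriv b (\<lambda>x. f x * g x)) x
        = dir_deriv b (\<lambda>x. f x * dir_deriv b g x + dir_deriv b f x * g x) x"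
      using d by (intro dir_deriv_cong[OF V(1,4)] dir_deriv_mult) auto
    also have "\<dots> = f x * dir_deriv b (dir_deriv b g) x + 2 * (dir_deriv b f x * dir_deriv b g x)
        + dir_deriv b (dir_deriv b f) x * g x"
      using d[OF V(4)] by (simp add: dir_deriv_add dir_deriv_mult)
    finally show ?thesis .
  qed
  then show ?thesis
    by (simp add: laplacian_def sum.distrib sum_distrib_left sum_distrib_right)
qed

lemma laplacian_cmult:
  assumes V: "open V" "smooth_on f V" "x \<in> V"
  shows "laplacian (\<lambda>x. c * f x) x = c * laplacian f x"
  using laplacian_mult[OF V(1) smooth_on_const[of c] V(2,3)] by simp

lemma laplacian_inner_self: "laplacian (\<lambda>x. x \<bullet> x) (x::'a::euclidean_space) = 2 * real DIM('a)"
proof -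
  have "dir_deriv b (\<lambda>x. x \<bullet> x) = (\<lambda>x. 2 * (x \<bullet> b))" for b :: 'a
    by (rule ext) simp
  moreover have "dir_deriv b (\<lambda>x. 2 * (x \<bullet> b)) x = 2" if "b \<in> Basis" for b :: 'a
    using that smooth_on_imp_differentiable[OF smooth_on_inner_left, of x UNIV b]
    by (simp add: dir_deriv_cmult)
  ultimately show ?thesis by (simp add: laplacian_def)
qed

lemma dir_deriv_diff:
  assumes "f differentiable (at x)" "g differentiable (at x)"
  shows "dir_deriv v (\<lambda>x. f x - g x) x = dir_deriv v f x - dir_deriv v g x"
  using dir_deriv_unique[OF has_derivative_diff[OF assms[THEN has_derivative_dir_deriv]]] .

lemma euler_diff:
  "f differentiable (at x) \<Longrightarrow> g differentiable (at x)
    \<Longrightarrow> euler (\<lambda>x. f x - g x) x = euler f x - euler g x"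
  by (simp add: euler_def dir_deriv_diff)

lemma laplacian_diff:
  assumes V: "open V" "smooth_on f V" "smooth_on g V" "x \<in> V"
  shows "laplacian (\<lambda>x. f x - g x) x = laplacian f x - laplacian g x"
  using laplacian_add[OF V(1,2) smooth_on_mult[OF V(1) smooth_on_const[of "-1"] V(3)] V(4)]
    laplacian_cmult[OF V(1,3,4), of "-1"] by simp

lemma laplacian_uminus:
  assumes V: "open V" "smooth_on f V" "x \<in> V"
  shows "laplacian (\<lambda>x. - f x) x = - laplacian f x"
  using laplacian_cmult[OF V, of "-1"] by simp

lemma laplacian_one_minus_mult:
  fixes f :: "'a::euclidean_space \<Rightarrow> real"
  assumes V: "open V" "smooth_on f V" "x \<in> V"
  shows "laplacian (\<lambda>x. (1 - x \<bullet> x) * f x) x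
    = (1 - x \<bullet> x) * laplacian f x - 4 * euler f x - 2 * real DIM('a) * f x"
proof -
  have f: "f differentiable (at x)" using smooth_on_imp_differentiable V(2,3) .
  have sm: "smooth_on (\<lambda>x. 1 - x \<bullet> x) V"
    using V(1) by (intro smooth_intros)
  have q: "laplacian (\<lambda>x. 1 - x \<bullet> x) x = - 2 * real DIM('a)"
    using laplacian_diff[OF V(1) smooth_on_const[of 1] smooth_on_inner_self[OF V(1)] V(3)]
    by (simp add: laplacian_inner_self)
  have q': "dir_deriv b (\<lambda>x. 1 - x \<bullet> x) x = - 2 * (x \<bullet> b)" for b
    by (rule dir_deriv_unique) (auto intro!: derivative_eq_intros simp: inner_commute)
  have "(\<Sum>b\<in>Basis. dir_deriv b (\<lambda>x. 1 - x \<bullet> x) x * dir_deriv b f x) = - 2 * euler f x"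
    by (simp add: q' euler_expand[OF f] sum_distrib_left mult.assoc)
  then show ?thesis
    unfolding laplacian_mult[OF V(1) sm V(2,3)] q by simp
qed

lemma laplacian_powr:
  assumes V: "open V" "smooth_on f V" "x \<in> V" and pos: "\<And>y. y \<in> V \<Longrightarrow> f y > 0"
  shows "laplacian (\<lambda>x. f x powr p) x = p * f x powr (p - 1) * laplacian f x
    + p * (p - 1) * f x powr (p - 2) * (\<Sum>b\<in>Basis. (dir_deriv b f x)\<^sup>2)"
proof -
  have d: "f differentiable (at y)" "dir_deriv b f differentiable (at y)"
    "(\<lambda>x. f x powr q) differentiable (at y)" if "y \<in> V" for b y q
    using V that pos
    by (auto intro!: smooth_on_imp_differentiable[where V = V] smooth_intros smooth_on_powr)
  have "dir_deriv b (dir_deriv b (\<lambda>x. f x powr p)) x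
      = p * f x powr (p - 1) * dir_deriv b (dir_deriv b f) x
        + p * (p - 1) * f x powr (p - 2) * (dir_deriv b f x)\<^sup>2" for b
  proof -
    have "dir_deriv b (dir_deriv b (\<lambda>x. f x powr p)) x
        = dir_deriv b (\<lambda>x. (p * f x powr (p - 1)) * dir_deriv b f x) x"
      using d pos by (intro dir_deriv_cong[OF V(1,3)]) (auto simp: dir_deriv_powr)
    also have "\<dots> = p * f x powr (p - 1) * dir_deriv b (dir_deriv b f) x
        + p * (p - 1) * f x powr (p - 2) * (dir_deriv b f x)\<^sup>2"
      using d[OF V(3)] pos[OF V(3)]
      by (subst dir_deriv_mult)
        (auto simp: dir_deriv_cmult dir_deriv_powr power2_eq_square intro!: differentiable_mult)
    finally show ?thesis .
  qed
  then show ?thesis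
    by (simp add: laplacian_def sum.distrib sum_distrib_left)
qed

text \<open>Each of the two derivatives in the Laplacian contributes one commutator with E, hence
  the factor 2. In particular E maps harmonic functions to harmonic functions.\<close>

lemma laplacian_euler:
  fixes f :: "'a::euclidean_space \<Rightarrow> real"
  assumes V: "open V" "smooth_on f V" "x \<in> V"
  shows "laplacian (euler f) x = euler (laplacian f) x + 2 * laplacian f x"
proof -
  have d: "dir_deriv b (dir_deriv b f) differentiable (at x)" "dir_deriv b f differentiable (at x)"
    "euler (dir_deriv b f) differentiable (at x)" for b
    using V by (auto intro!: smooth_on_imp_differentiable[where V = V] smooth_intros smooth_on_euler)
  have "dir_deriv b (dir_deriv b (euler f)) x
      = 2 * dir_deriv b (dir_deriv b f) x + euler (dir_deriv b (dir_deriv b f)) x" for b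
  proof -
    have "dir_deriv b (dir_deriv b (euler f)) x
        = dir_deriv b (\<lambda>x. dir_deriv b f x + euler (dir_deriv b f) x) x"
      by (intro dir_deriv_cong[OF V(1,3)] dir_deriv_euler[OF V(1,2)])
    also have "\<dots> = 2 * dir_deriv b (dir_deriv b f) x + euler (dir_deriv b (dir_deriv b f)) x"
      using d dir_deriv_euler[OF V(1) smooth_on_dir_deriv[OF V(1,2)] V(3)]
      by (simp add: dir_deriv_add)
    finally show ?thesis .
  qed
  moreover have "euler (laplacian f) x = (\<Sum>b\<in>Basis. euler (dir_deriv b (dir_deriv b f)) x)"
    unfolding euler_def laplacian_def[abs_def] using d by (intro dir_deriv_sum)
  ultimately show ?thesis
    by (simp add: laplacian_def sum.distrib sum_distrib_left)
qed

subsection \<open>The boundary operators on the sphere\<close>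

text \<open>The derivative of \<open>sgn\<close> at \<open>y\<close> is the orthogonal projection
  along \<open>y\<close>, divided by the norm of \<open>y\<close>. The component that the projection
  removes gives the term with \<open>euler\<close>.\<close>

lemma dir_deriv_comp_sgn:
  fixes f :: "'a::euclidean_space \<Rightarrow> real"
  assumes y: "y \<noteq> 0" and f: "f differentiable (at (sgn y))"
  shows "(\<lambda>z. f (sgn z)) differentiable (at y)"
    and "dir_deriv v (\<lambda>z. f (sgn z)) y
      = inverse (norm y) * dir_deriv v f (sgn y) - (y \<bullet> v) * (inverse (norm y))\<^sup>2 * euler f (sgn y)"
proof -
  define r where "r = inverse (norm y)"
  have r: "r > 0" using y by (simp add: r_def)
  have "((\<lambda>z. inverse (norm z) *\<^sub>R z) has_derivative (\<lambda>v. r *\<^sub>R v - ((y \<bullet> v) * r ^ 3) *\<^sub>R y)) (at y)"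
    using y by (auto intro!: derivative_eq_intros has_derivative_norm
        simp: fun_eq_iff sgn_div_norm r_def power3_eq_cube algebra_simps inner_commute)
  then have "(sgn has_derivative (\<lambda>v. r *\<^sub>R v - ((y \<bullet> v) * r ^ 3) *\<^sub>R y)) (at y)"
    by (simp add: sgn_div_norm[abs_def])
  from has_derivative_compose[OF this has_derivative_dir_deriv[OF f]]
  have D: "((\<lambda>z. f (sgn z)) has_derivative
      (\<lambda>v. dir_deriv (r *\<^sub>R v - ((y \<bullet> v) * r ^ 3) *\<^sub>R y) f (sgn y))) (at y)" .
  then show "(\<lambda>z. f (sgn z)) differentiable (at y)"
    by (auto simp: differentiable_def)
  have lin: "linear (\<lambda>v. dir_deriv v f (sgn y))" by (rule dir_deriv_linear[OF f])
  have e: "euler f (sgn y) = r * dir_deriv y f (sgn y)"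
    unfolding euler_def using linear_scale[OF lin, of r y] by (simp add: sgn_div_norm r_def)
  have "dir_deriv v (\<lambda>z. f (sgn z)) y = r * dir_deriv v f (sgn y) - (y \<bullet> v) * r ^ 3 * dir_deriv y f (sgn y)"
    unfolding dir_deriv_unique[OF D] linear_diff[OF lin] linear_scale[OF lin] by simp
  then show "dir_deriv v (\<lambda>z. f (sgn z)) y
      = inverse (norm y) * dir_deriv v f (sgn y) - (y \<bullet> v) * (inverse (norm y))\<^sup>2 * euler f (sgn y)"
    unfolding e r_def[symmetric] by (simp add: power2_eq_square power3_eq_cube)
qed

text \<open>The polar decomposition of the Laplacian at radius 1, with the radial part written in
  powers of E. It is obtained by differentiating the extension that is constant along rays twice in
  each basis direction and summing.\<close>

lemma sphere_laplacian_eq: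
  fixes f :: "'a::euclidean_space \<Rightarrow> real"
  assumes V: "open V" "smooth_on f V" "\<xi> \<in> V" and \<xi>: "norm \<xi> = 1"
  shows "sphere_laplacian f \<xi> = laplacian f \<xi> - euler (euler f) \<xi> - (real DIM('a) - 2) * euler f \<xi>"
proof -
  \<comment> \<open>The cone over \<open>V\<close>: an open set on which the first derivatives of
    the ray-constant extension are known, so that they can be differentiated again at
    \<open>\<xi>\<close>.\<close>
  define N where "N = {y. y \<noteq> 0 \<and> sgn y \<in> V}"
  have "continuous_on (-{0::'a}) sgn"
    by (intro continuous_intros) auto
  then have "open (sgn -` V \<inter> -{0})"
    using V(1) by (intro continuous_on_open_vimage[THEN iffD1, rule_format]) auto
  moreover have "N = sgn -` V \<inter> -{0}" by (auto simp: N_def)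
  ultimately have N: "open N" by simp
  have sgn_\<xi>: "sgn \<xi> = \<xi>" using \<xi> by (simp add: sgn_div_norm)
  have \<xi>N: "\<xi> \<in> N" "\<xi> \<noteq> 0" using V \<xi> by (auto simp: N_def sgn_\<xi>)
  have d: "f differentiable (at y)" "dir_deriv b f differentiable (at y)" "euler f differentiable (at y)"
    if "y \<in> V" for y b
    using V that by (auto intro!: smooth_on_imp_differentiable[where V = V] smooth_intros smooth_on_euler)
  have inv: "((\<lambda>z. inverse (norm z)) has_derivative (\<lambda>v. - (\<xi> \<bullet> v))) (at \<xi>)"
    using \<xi> \<xi>N(2)
    by (auto intro!: derivative_eq_intros has_derivative_norm simp: sgn_\<xi> inner_commute)
  have second: "dir_deriv b (dir_deriv b (\<lambda>z. f (sgn z))) \<xi>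
      = dir_deriv b (dir_deriv b f) \<xi> - euler f \<xi>
        + 2 * (\<xi> \<bullet> b)\<^sup>2 * euler f \<xi> + (\<xi> \<bullet> b)\<^sup>2 * euler (euler f) \<xi>
        - 2 * ((\<xi> \<bullet> b) * dir_deriv b (euler f) \<xi>)"
    if b: "b \<in> Basis" for b
  proof -
    have "dir_deriv b (dir_deriv b (\<lambda>z. f (sgn z))) \<xi>
        = dir_deriv b (\<lambda>y. inverse (norm y) * dir_deriv b f (sgn y)
            - (y \<bullet> b) * (inverse (norm y))\<^sup>2 * euler f (sgn y)) \<xi>"
      using d by (intro dir_deriv_cong[OF N \<xi>N(1)] dir_deriv_comp_sgn(2)) (auto simp: N_def)
    also have "\<dots> = (dir_deriv b (dir_deriv b f) \<xi> - (\<xi> \<bullet> b) * euler (dir_deriv b f) \<xi>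
          - (\<xi> \<bullet> b) * dir_deriv b f \<xi>)
        - (euler f \<xi> - 2 * (\<xi> \<bullet> b)\<^sup>2 * euler f \<xi>
          + (\<xi> \<bullet> b) * (dir_deriv b (euler f) \<xi> - (\<xi> \<bullet> b) * euler (euler f) \<xi>))"
    proof -
      have A: "((\<lambda>z. dir_deriv b f (sgn z)) has_derivative
          (\<lambda>v. dir_deriv v (dir_deriv b f) \<xi> - (\<xi> \<bullet> v) * euler (dir_deriv b f) \<xi>)) (at \<xi>)"
        using has_derivative_dir_deriv[OF dir_deriv_comp_sgn(1)[OF \<xi>N(2)], of "dir_deriv b f"]
          dir_deriv_comp_sgn(2)[OF \<xi>N(2), of "dir_deriv b f"] d[OF V(3)] sgn_\<xi> \<xi> by simp
      have C: "((\<lambda>z. euler f (sgn z)) has_derivative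
          (\<lambda>v. dir_deriv v (euler f) \<xi> - (\<xi> \<bullet> v) * euler (euler f) \<xi>)) (at \<xi>)"
        using has_derivative_dir_deriv[OF dir_deriv_comp_sgn(1)[OF \<xi>N(2)], of "euler f"]
          dir_deriv_comp_sgn(2)[OF \<xi>N(2), of "euler f"] d[OF V(3)] sgn_\<xi> \<xi> by simp
      have inv2: "((\<lambda>z. (inverse (norm z))\<^sup>2) has_derivative (\<lambda>v. - 2 * (\<xi> \<bullet> v))) (at \<xi>)"
        using has_derivative_power[OF inv, of 2] \<xi> by (simp add: algebra_simps)
      have lin: "((\<lambda>z. z \<bullet> b) has_derivative (\<lambda>v. v \<bullet> b)) (at \<xi>)"
        by (auto intro!: derivative_eq_intros)
      show ?thesis
        unfolding dir_deriv_unique[OF has_derivative_diff[OF has_derivative_mult[OF inv A]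
              has_derivative_mult[OF has_derivative_mult[OF lin inv2] C]]]
        using b by (simp add: sgn_\<xi> \<xi> power2_eq_square algebra_simps)
    qed
    also have "\<dots> = dir_deriv b (dir_deriv b f) \<xi> - euler f \<xi>
        + 2 * (\<xi> \<bullet> b)\<^sup>2 * euler f \<xi> + (\<xi> \<bullet> b)\<^sup>2 * euler (euler f) \<xi>
        - 2 * ((\<xi> \<bullet> b) * dir_deriv b (euler f) \<xi>)"
      unfolding dir_deriv_euler[OF V] by (simp add: power2_eq_square algebra_simps)
    finally show ?thesis .
  qed
  have 1: "(\<Sum>b\<in>Basis. (\<xi> \<bullet> b)\<^sup>2) = 1"
    using \<xi> euclidean_inner[of \<xi> \<xi>] by (simp add: norm_eq_1 power2_eq_square)
  have "sphere_laplacian f \<xi> = (\<Sum>b\<in>Basis. dir_deriv b (dir_deriv b f) \<xi> - euler f \<xi>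
        + 2 * (\<xi> \<bullet> b)\<^sup>2 * euler f \<xi> + (\<xi> \<bullet> b)\<^sup>2 * euler (euler f) \<xi>
        - 2 * ((\<xi> \<bullet> b) * dir_deriv b (euler f) \<xi>))"
    unfolding sphere_laplacian_def laplacian_def[of "\<lambda>y. f (sgn y)"]
    using second by (intro sum.cong) auto
  \<comment> \<open>On summation the squared coordinates add up to 1, and the derivatives of
    \<open>euler f\<close> weighted by the coordinates to \<open>euler (euler f)\<close>.\<close>
  also have "\<dots> = laplacian f \<xi> - real DIM('a) * euler f \<xi> + 2 * euler f \<xi>
      + euler (euler f) \<xi> - 2 * euler (euler f) \<xi>"
    using euler_expand[OF d(3)[OF V(3)]] 1
    by (simp add: sum.distrib sum_subtractf laplacian_def flip: sum_distrib_left sum_distrib_right)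
  finally show ?thesis by (simp add: algebra_simps)
qed

lemma radial_deriv_eq: "norm \<xi> = 1 \<Longrightarrow> radial_deriv U \<xi> = euler U \<xi>"
  by (simp add: radial_deriv_def euler_def sgn_div_norm)

text \<open>Away from the origin the radial derivative is E divided by the norm. On the unit sphere
  E maps the reciprocal of the norm to -1, which gives the second term.\<close>

lemma radial_deriv_radial_deriv_eq:
  fixes U :: "'a::euclidean_space \<Rightarrow> real"
  assumes V: "open V" "smooth_on U V" "\<xi> \<in> V" and \<xi>: "norm \<xi> = 1"
  shows "radial_deriv (radial_deriv U) \<xi> = euler (euler U) \<xi> - euler U \<xi>"
proof -
  have N: "open (V - {0})" "\<xi> \<in> V - {0}" using V \<xi> by auto
  have "sgn \<xi> = \<xi>" using \<xi> by (simp add: sgn_div_norm)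
  moreover have "\<xi> \<bullet> \<xi> = 1" using \<xi> by (simp add: norm_eq_1)
  ultimately have inv: "((\<lambda>z. inverse (norm z)) has_derivative (\<lambda>v. - (\<xi> \<bullet> v))) (at \<xi>)"
    using \<xi> N(2) by (auto intro!: derivative_eq_intros has_derivative_norm simp: inner_commute)
  have d: "euler U differentiable (at \<xi>)"
    using V by (auto intro!: smooth_on_imp_differentiable[where V = V] smooth_intros smooth_on_euler)
  have "radial_deriv U y = inverse (norm y) * euler U y" if "y \<in> V - {0}" for y
    using linear_scale[OF dir_deriv_linear[OF smooth_on_imp_differentiable[OF V(2)]], of y "inverse (norm y)" y] that
    by (simp add: radial_deriv_def euler_def sgn_div_norm)
  then have "radial_deriv (radial_deriv U) \<xi> = euler (\<lambda>y. inverse (norm y) * euler U y) \<xi>"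
    unfolding radial_deriv_eq[OF \<xi>] by (intro euler_cong[OF N])
  also have "\<dots> = euler (euler U) \<xi> - euler U \<xi>"
    unfolding euler_def[of "\<lambda>y. inverse (norm y) * euler U y"]
      dir_deriv_unique[OF has_derivative_mult[OF inv has_derivative_dir_deriv[OF d]]]
    using \<open>\<xi> \<bullet> \<xi> = 1\<close> \<xi> by (simp add: euler_def[of "euler U"])
  finally show ?thesis .
qed

text \<open>Only the values at \<open>sgn y\<close> enter, and there the radial direction
  \<open>sgn (sgn y)\<close> is the point \<open>sgn y\<close> itself.\<close>

lemma sphere_laplacian_radial_deriv:
  fixes U :: "'a::euclidean_space \<Rightarrow> real"
  shows "sphere_laplacian (radial_deriv U) \<xi> = sphere_laplacian (euler U) \<xi>"
proof -
  have "sgn (sgn y) = sgn y" for y :: 'a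
    by (cases "y = 0") (simp_all add: sgn_div_norm)
  then show ?thesis
    by (simp add: sphere_laplacian_def radial_deriv_def euler_def)
qed

section \<open>Expression of the boundary operators through one second-order operator\<close>

text \<open>The function called V in the introduction. In the lemmas the letter \<open>V\<close>
  denotes an open set.\<close>

definition conformal_op :: "nat \<Rightarrow> ('a::euclidean_space \<Rightarrow> real) \<Rightarrow> 'a \<Rightarrow> real" where
  "conformal_op n U x = (1 - x \<bullet> x) * laplacian U x + 4 * euler U x + 2 * (real n - 3) * U x"

lemma smooth_on_conformal_op:
  assumes "open V" "smooth_on U V"
  shows "smooth_on (conformal_op n U) V"
  unfolding conformal_op_def[abs_def] using assms by (intro smooth_intros smooth_on_euler)

text \<open>The product with \<open>1 - x \<bullet> x\<close> produces -4 E w - 2 (n + 1) w, where w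
  is the Laplacian of \<open>U\<close>. The terms 4 E w + 8 w from \<open>4 * euler U\<close> and 2
  (n - 3) w from the last summand cancel this exactly.\<close>

lemma laplacian_conformal_op:
  fixes U :: "'a::euclidean_space \<Rightarrow> real"
  assumes V: "open V" "smooth_on U V" "x \<in> V" and n: "DIM('a) = n + 1"
  shows "laplacian (conformal_op n U) x = (1 - x \<bullet> x) * laplacian (laplacian U) x"
proof -
  note sm = smooth_intros smooth_on_euler V
  have "laplacian (conformal_op n U) x = laplacian (\<lambda>x. (1 - x \<bullet> x) * laplacian U x) x
      + 4 * laplacian (euler U) x + 2 * (real n - 3) * laplacian U x"
    unfolding conformal_op_def[abs_def]
    by (subst laplacian_add[where V = V] laplacian_cmult[where V = V]; (intro sm)?)+ simp
  then show ?thesis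
    unfolding laplacian_one_minus_mult[OF V(1) smooth_on_laplacian[OF V(1,2)] V(3)]
      laplacian_euler[OF V] n by (simp add: algebra_simps)
qed

lemma euler_conformal_op:
  assumes V: "open V" "smooth_on U V" "x \<in> V"
  shows "euler (conformal_op n U) x = (1 - x \<bullet> x) * euler (laplacian U) x - 2 * (x \<bullet> x) * laplacian U x
    + 4 * euler (euler U) x + 2 * (real n - 3) * euler U x"
proof -
  have d: "laplacian U differentiable (at x)" "euler U differentiable (at x)" "U differentiable (at x)"
    using V by (auto intro!: smooth_on_imp_differentiable[where V = V] smooth_intros smooth_on_euler)
  have D: "(conformal_op n U has_derivative (\<lambda>v. (1 - x \<bullet> x) * dir_deriv v (laplacian U) x
      - 2 * (x \<bullet> v) * laplacian U x + 4 * dir_deriv v (euler U) x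
      + 2 * (real n - 3) * dir_deriv v U x)) (at x)"
    unfolding conformal_op_def
    by (auto intro!: derivative_eq_intros d[THEN has_derivative_dir_deriv]
        simp: fun_eq_iff inner_commute algebra_simps)
  show ?thesis
    unfolding euler_def[of "conformal_op n U"] dir_deriv_unique[OF D] by (simp flip: euler_def)
qed

text \<open>The factor \<open>1 - x \<bullet> x\<close> vanishes on the sphere but may be dropped
  only after the outer derivative, since E maps it to -2 there.\<close>

lemma euler_euler_conformal_op:
  assumes V: "open V" "smooth_on U V" "x \<in> V" and x: "norm x = 1"
  shows "euler (euler (conformal_op n U)) x = - 4 * laplacian U x - 4 * euler (laplacian U) x
    + 4 * euler (euler (euler U)) x + 2 * (real n - 3) * euler (euler U) x"
proof -
  have d: "laplacian U differentiable (at x)" "euler (laplacian U) differentiable (at x)"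
    "euler U differentiable (at x)" "euler (euler U) differentiable (at x)"
    using V by (auto intro!: smooth_on_imp_differentiable[where V = V] smooth_intros smooth_on_euler)
  have D: "((\<lambda>x. (1 - x \<bullet> x) * euler (laplacian U) x
    - 2 * (x \<bullet> x) * laplacian U x + 4 * euler (euler U) x + 2 * (real n - 3) * euler U x)
    has_derivative (\<lambda>v. (1 - x \<bullet> x) * dir_deriv v (euler (laplacian U)) x
      - 2 * (x \<bullet> v) * euler (laplacian U) x - 4 * (x \<bullet> v) * laplacian U x
      - 2 * (x \<bullet> x) * dir_deriv v (laplacian U) x + 4 * dir_deriv v (euler (euler U)) x
      + 2 * (real n - 3) * dir_deriv v (euler U) x)) (at x)"
    by (auto intro!: derivative_eq_intros d[THEN has_derivative_dir_deriv]
        simp: fun_eq_iff inner_commute algebra_simps)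
  have "euler (euler (conformal_op n U)) x = euler (\<lambda>x. (1 - x \<bullet> x) * euler (laplacian U) x
    - 2 * (x \<bullet> x) * laplacian U x + 4 * euler (euler U) x + 2 * (real n - 3) * euler U x) x"
    by (intro euler_cong[OF V(1,3)] euler_conformal_op[OF V(1,2)])
  also have "\<dots> = - 4 * laplacian U x - 4 * euler (laplacian U) x
    + 4 * euler (euler (euler U)) x + 2 * (real n - 3) * euler (euler U) x"
    using dir_deriv_unique[OF D, of x] x[unfolded norm_eq_1] by (simp flip: euler_def)
  finally show ?thesis .
qed

lemma bdry_op1_eq:
  assumes "norm \<xi> = 1"
  shows "bdry_op1 n U \<xi> = conformal_op n U \<xi> / 4"
  using assms[unfolded norm_eq_1]
  by (simp add: bdry_op1_def conformal_op_def radial_deriv_eq[OF assms] field_simps)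

lemma bdry_op2_eq:
  fixes U :: "'a::euclidean_space \<Rightarrow> real"
  assumes V: "open V" "smooth_on U V" "\<xi> \<in> V" and \<xi>: "norm \<xi> = 1" and n: "DIM('a) = n + 1"
  shows "bdry_op2 n U \<xi> = euler (conformal_op n U) \<xi> / 2 + (real n - 1) / 4 * conformal_op n U \<xi>"
  using \<xi>[unfolded norm_eq_1]
  unfolding bdry_op2_def unfolding radial_deriv_radial_deriv_eq[OF V \<xi>]
  unfolding sphere_laplacian_eq[OF V \<xi>]
    radial_deriv_eq[OF \<xi>] euler_conformal_op[OF V] conformal_op_def n
  by (simp add: field_simps)

text \<open>The expanded form of the product formula of the introduction. Once the spherical
  Laplacians are eliminated and the Laplacian is commuted with E, both sides are combinations of w,
  E w, \<open>U\<close>, E \<open>U\<close>, E E \<open>U\<close> and E E E \<open>U\<close>, with w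
  the Laplacian of \<open>U\<close>, and the coefficients agree.\<close>

lemma bdry_op3_eq:
  fixes U :: "'a::euclidean_space \<Rightarrow> real"
  assumes V: "open V" "smooth_on U V" "\<xi> \<in> V" and \<xi>: "norm \<xi> = 1" and n: "DIM('a) = n + 1"
  shows "bdry_op3 n U \<xi> = - euler (laplacian U) \<xi> - (real n - 1) / 2 * laplacian U \<xi>
    + euler (euler (conformal_op n U)) \<xi> / 2 + real n / 2 * euler (conformal_op n U) \<xi>
    + ((real n)\<^sup>2 - 1) / 8 * conformal_op n U \<xi>"
  using \<xi>[unfolded norm_eq_1]
  unfolding bdry_op3_def unfolding radial_deriv_radial_deriv_eq[OF V \<xi>]
  unfolding sphere_laplacian_radial_deriv
    sphere_laplacian_eq[OF V \<xi>] sphere_laplacian_eq[OF V(1) smooth_on_euler[OF V(1,2)] V(3) \<xi>]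
    radial_deriv_eq[OF \<xi>] euler_euler_conformal_op[OF V \<xi>] euler_conformal_op[OF V] conformal_op_def
    laplacian_euler[OF V] n
  by (simp add: field_simps power2_eq_square)

subsection \<open>Maximum principles and uniqueness\<close>

text \<open>Along the line through \<open>x\<close> the first derivative vanishes at the maximum. If
  the second were positive, the first would be positive just to the right, and the function would
  exceed its maximum.\<close>

lemma second_dir_deriv_nonpos_at_max:
  fixes f :: "'a::euclidean_space \<Rightarrow> real"
  assumes V: "open V" "smooth_on f V" "x \<in> V" and max: "\<And>y. y \<in> V \<Longrightarrow> f y \<le> f x"
  shows "dir_deriv b (dir_deriv b f) x \<le> 0"
proof (rule ccontr)
  assume "\<not> dir_deriv b (dir_deriv b f) x \<le> 0"
  then have pos: "dir_deriv b (dir_deriv b f) x > 0" by simp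
  define g where "g = (\<lambda>t. f (x + t *\<^sub>R b))"
  define g' where "g' = (\<lambda>t. dir_deriv b f (x + t *\<^sub>R b))"
  have "open ((\<lambda>t. x + t *\<^sub>R b) -` V)"
    by (intro open_vimage V(1) continuous_intros)
  moreover have "0 \<in> (\<lambda>t. x + t *\<^sub>R b) -` V" using V(3) by simp
  ultimately obtain d where d: "d > 0" "ball 0 d \<subseteq> (\<lambda>t. x + t *\<^sub>R b) -` V"
    using open_contains_ball by blast
  have inV: "x + t *\<^sub>R b \<in> V" if "\<bar>t\<bar> < d" for t
    using d(2) that by (auto simp: dist_real_def)
  have g: "(g has_real_derivative g' t) (at t)" if "\<bar>t\<bar> < d" for t
    unfolding g_def g'_def
    by (intro has_real_derivative_along_line smooth_on_imp_differentiable[OF V(2) inV[OF that]])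
  have "g' 0 = 0"
    using g[of 0] d(1) by (rule DERIV_local_max) (use d inV max in \<open>auto simp: g_def\<close>)
  have "(g' has_real_derivative dir_deriv b (dir_deriv b f) (x + 0 *\<^sub>R b)) (at 0)"
    unfolding g'_def using V
    by (intro has_real_derivative_along_line
        smooth_on_imp_differentiable[OF smooth_on_dir_deriv[OF V(1,2)]]) auto
  then have "(g' has_real_derivative dir_deriv b (dir_deriv b f) x) (at 0)" by simp
  from DERIV_pos_inc_right[OF this pos] obtain e where
    e: "e > 0" "\<And>h. 0 < h \<Longrightarrow> h < e \<Longrightarrow> g' 0 < g' h" by auto
  define h where "h = min d e / 2"
  have h: "0 < h" "h < d" "h < e" using d(1) e(1) by (auto simp: h_def)
  have "\<exists>z>0. z < h \<and> g h - g 0 = (h - 0) * g' z"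
    using h by (intro MVT2 g) auto
  then obtain z where z: "0 < z" "z < h" "g h - g 0 = h * g' z" by auto
  have "g' z > 0" using e(2)[of z] z h \<open>g' 0 = 0\<close> by simp
  then have "g h > g 0" using z(3) h(1) mult_pos_pos[of h "g' z"] by linarith
  moreover have "g h \<le> g 0" using max[OF inV[of h]] h by (simp add: g_def)
  ultimately show False by simp
qed

text \<open>Weak maximum principle. Adding a small multiple of |x|^2 makes the Laplacian strictly
  positive, which excludes an interior maximum.\<close>

lemma subharmonic_nonpos:
  fixes f :: "'a::euclidean_space \<Rightarrow> real"
  assumes cont: "continuous_on (cball 0 1) f" and sm: "smooth_on f (ball 0 1)"
    and lap: "\<And>x. x \<in> ball 0 1 \<Longrightarrow> laplacian f x \<ge> 0"
    and bd: "\<And>x. x \<in> sphere 0 1 \<Longrightarrow> f x \<le> 0" and z: "z \<in> cball 0 1"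
  shows "f z \<le> 0"
proof (rule ccontr)
  assume "\<not> f z \<le> 0"
  then have fz: "f z > 0" by simp
  \<comment> \<open>Half the supposed positive value: on the sphere \<open>g\<close> is at most
    \<open>e\<close>, which is below \<open>f z\<close>, so the maximum of \<open>g\<close> lies in
    the open ball.\<close>
  define e where "e = f z / 2"
  define g where "g = (\<lambda>x. f x + e * (x \<bullet> x))"
  have e: "e > 0" using fz by (simp add: e_def)
  have "continuous_on (cball 0 1) g"
    unfolding g_def by (intro continuous_intros cont)
  then obtain p where p: "p \<in> cball 0 1" "\<And>y. y \<in> cball 0 1 \<Longrightarrow> g y \<le> g p"
    using continuous_attains_sup[OF compact_cball, of 0 1 g] by auto
  have "0 \<le> e * (z \<bullet> z)" using e by simp
  then have gp: "g p \<ge> f z" using p(2)[OF z] unfolding g_def by linarith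
  have "norm p \<noteq> 1"
  proof
    assume "norm p = 1"
    then have "g p \<le> e" using bd[of p] by (simp add: g_def norm_eq_1)
    then show False using gp fz by (simp add: e_def)
  qed
  then have pb: "p \<in> ball 0 1" using p(1) by simp
  have smg: "smooth_on (\<lambda>x. e * (x \<bullet> x)) (ball 0 1)" by (intro smooth_intros open_ball)
  have "dir_deriv b (dir_deriv b g) p \<le> 0" for b
    using p(2) pb
    by (intro second_dir_deriv_nonpos_at_max[of "ball 0 1"])
      (auto simp: g_def intro!: smooth_on_add[OF open_ball sm smg])
  then have "laplacian g p \<le> 0"
    unfolding laplacian_def by (intro sum_nonpos)
  moreover have "laplacian g p = laplacian f p + e * (2 * real DIM('a))"
    unfolding g_def laplacian_add[OF open_ball sm smg pb]
      laplacian_cmult[OF open_ball smooth_on_inner_self[OF open_ball] pb] laplacian_inner_self ..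
  moreover have "e * (2 * real DIM('a)) > 0" using e by simp
  ultimately show False using lap[OF pb] by linarith
qed

lemma harmonic_dirichlet_zero:
  fixes f :: "'a::euclidean_space \<Rightarrow> real"
  assumes cont: "continuous_on (cball 0 1) f" and sm: "smooth_on f (ball 0 1)"
    and lap: "\<And>x. x \<in> ball 0 1 \<Longrightarrow> laplacian f x = 0"
    and bd: "\<And>x. x \<in> sphere 0 1 \<Longrightarrow> f x = 0" and z: "z \<in> cball 0 1"
  shows "f z = 0"
proof -
  have "f z \<le> 0"
    by (rule subharmonic_nonpos[OF cont sm _ _ z]) (simp_all add: lap bd)
  moreover have "- f z \<le> 0"
    by (rule subharmonic_nonpos[OF continuous_on_minus[OF cont] smooth_on_uminus[OF open_ball sm] _ _ z])
      (simp_all add: lap bd laplacian_uminus[OF open_ball sm])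
  ultimately show ?thesis by simp
qed

text \<open>At a maximum point \<open>p\<close> over the closed ball the segment towards the origin
  stays in the ball, so \<open>euler f p\<close> is nonnegative. The equation and
  \<open>a > 0\<close> then make the maximum nonpositive.\<close>

lemma euler_robin_nonpos:
  fixes f :: "'a::euclidean_space \<Rightarrow> real"
  assumes d: "\<And>x. x \<in> cball 0 1 \<Longrightarrow> f differentiable (at x)" and a: "a > 0"
    and eq: "\<And>x. x \<in> cball 0 1 \<Longrightarrow> euler f x + a * f x = 0" and z: "z \<in> cball 0 1"
  shows "f z \<le> 0"
proof -
  have "continuous_on (cball 0 1) f"
    using d by (simp add: continuous_at_imp_continuous_on differentiable_imp_continuous_within)
  then obtain p where p: "p \<in> cball 0 1" "\<And>y. y \<in> cball 0 1 \<Longrightarrow> f y \<le> f p"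
    using continuous_attains_sup[OF compact_cball, of 0 1 f] by auto
  have "((\<lambda>t. f (0 + t *\<^sub>R p)) has_real_derivative dir_deriv p f (0 + 1 *\<^sub>R p)) (at 1)"
    using d[OF p(1)] by (intro has_real_derivative_along_line) simp
  then have D: "((\<lambda>t. f (t *\<^sub>R p)) has_real_derivative euler f p) (at 1)"
    by (simp add: euler_def)
  have "euler f p \<ge> 0"
  proof (rule ccontr)
    assume "\<not> euler f p \<ge> 0"
    then have "euler f p < 0" by simp
    from DERIV_neg_dec_left[OF D this] obtain e where
      e: "e > 0" "\<And>h. 0 < h \<Longrightarrow> h < e \<Longrightarrow> f (1 *\<^sub>R p) < f ((1 - h) *\<^sub>R p)" by auto
    define h where "h = min e 1 / 2"
    have h: "0 < h" "h < e" "h < 1" using e(1) by (auto simp: h_def)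
    have "(1 - h) * norm p \<le> 1 * 1"
      using p(1) h by (intro mult_mono) auto
    then have "f ((1 - h) *\<^sub>R p) \<le> f p"
      using h by (intro p(2)) simp
    then show False using e(2)[OF h(1,2)] by simp
  qed
  then have "f p \<le> 0" using eq[OF p(1)] mult_pos_pos[OF a, of "f p"] by linarith
  then show ?thesis using p(2)[OF z] by simp
qed

lemma euler_robin_zero:
  fixes f :: "'a::euclidean_space \<Rightarrow> real"
  assumes d: "\<And>x. x \<in> cball 0 1 \<Longrightarrow> f differentiable (at x)" and a: "a > 0"
    and eq: "\<And>x. x \<in> cball 0 1 \<Longrightarrow> euler f x + a * f x = 0" and z: "z \<in> cball 0 1"
  shows "f z = 0"
proof -
  have "f z \<le> 0" by (rule euler_robin_nonpos[OF d a eq z])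
  moreover have "(\<lambda>x. (-1) * f x) z \<le> 0"
  proof (rule euler_robin_nonpos[OF _ a _ z])
    fix x :: 'a assume x: "x \<in> cball 0 1"
    show "(\<lambda>x. (-1) * f x) differentiable (at x)"
      using d[OF x] by simp
    show "euler (\<lambda>x. (-1) * f x) x + a * ((-1) * f x) = 0"
      unfolding euler_cmult[OF d[OF x]] using eq[OF x] by simp
  qed
  ultimately show ?thesis by simp
qed

text \<open>Carries identities obtained by differentiating inside the open ball over to the
  sphere.\<close>

lemma zero_on_cball_if_zero_on_ball:
  fixes f :: "'a::euclidean_space \<Rightarrow> real"
  assumes "continuous_on (cball 0 1) f" "\<And>x. x \<in> ball 0 1 \<Longrightarrow> f x = 0" "z \<in> cball 0 1"
  shows "f z = 0"
  using continuous_constant_on_closure[of "ball 0 1" f 0 z] assms by simp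

text \<open>\<open>euler f + a * f\<close> is harmonic because E preserves harmonicity. It vanishes
  on the sphere, hence in the whole ball, and a first-order equation along the rays remains.\<close>

lemma harmonic_robin_zero:
  fixes f :: "'a::euclidean_space \<Rightarrow> real"
  assumes V: "open V" "smooth_on f V" "cball 0 1 \<subseteq> V" and a: "a > 0"
    and lap: "\<And>x. x \<in> ball 0 1 \<Longrightarrow> laplacian f x = 0"
    and bd: "\<And>x. x \<in> sphere 0 1 \<Longrightarrow> euler f x + a * f x = 0" and z: "z \<in> cball 0 1"
  shows "f z = 0"
proof (rule euler_robin_zero[OF _ a _ z])
  fix x :: 'a assume x: "x \<in> cball 0 1"
  show "f differentiable (at x)"
    using smooth_on_imp_differentiable[OF V(2)] x V(3) by auto
  have B: "ball 0 1 \<subseteq> V" using V(3) by auto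
  define h where "h = (\<lambda>x. euler f x + a * f x)"
  have sm1: "smooth_on (euler f) V" "smooth_on (\<lambda>x. a * f x) V"
    using V by (auto intro!: smooth_on_euler smooth_intros)
  have sm: "smooth_on h V"
    unfolding h_def using V(1) sm1 by (rule smooth_on_add)
  have "laplacian h y = 0" if y: "y \<in> ball 0 1" for y
  proof -
    have yV: "y \<in> V" using y B by auto
    have "euler (laplacian f) y = euler (\<lambda>_. 0) y"
      by (rule euler_cong[OF open_ball y]) (rule lap)
    then show ?thesis
      unfolding h_def laplacian_add[OF V(1) sm1 yV] laplacian_euler[OF V(1,2) yV]
        laplacian_cmult[OF V(1,2) yV] lap[OF y] by simp
  qed
  from harmonic_dirichlet_zero[OF continuous_on_subset[OF smooth_on_imp_continuous_on[OF sm] V(3)]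
      smooth_on_subset[OF sm B] this _ x] bd
  show "euler f x + a * f x = 0" by (simp add: h_def)
qed

lemma biharmonic_unique:
  fixes U :: "'a::euclidean_space \<Rightarrow> real"
  assumes V: "open V" "smooth_on U V" "cball 0 1 \<subseteq> V"
    and n: "DIM('a) = n + 1" "n \<ge> 2" "n \<noteq> 3"
    and ij: "i < j" "j \<le> 3" "i + j \<noteq> 3"
    and bih: "\<And>x. x \<in> ball 0 1 \<Longrightarrow> laplacian (laplacian U) x = 0"
    and bi: "\<And>x. x \<in> sphere 0 1 \<Longrightarrow> bdry_op n i U x = 0"
    and bj: "\<And>x. x \<in> sphere 0 1 \<Longrightarrow> bdry_op n j U x = 0"
    and z: "z \<in> cball 0 1"
  shows "U z = 0"
proof -
  define C where "C = conformal_op n U"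
  define w where "w = laplacian U"
  have B: "ball 0 1 \<subseteq> V" and S: "sphere 0 1 \<subseteq> V" using V(3) by auto
  have sm: "smooth_on C V" "smooth_on w V" "smooth_on (euler C) V" "smooth_on (euler (euler C)) V"
    using V(1,2) by (auto simp: C_def w_def intro!: smooth_on_conformal_op smooth_on_laplacian smooth_on_euler)
  have cont: "continuous_on (cball 0 1) f" if "smooth_on f V" for f
    using continuous_on_subset[OF smooth_on_imp_continuous_on[OF that] V(3)] .
  have diff: "f differentiable (at x)" if "smooth_on f V" "x \<in> cball 0 1" for f x
    using smooth_on_imp_differentiable[OF that(1)] that(2) V(3) by auto
  have lapC: "laplacian C x = 0" if "x \<in> ball 0 1" for x
    using laplacian_conformal_op[OF V(1,2) _ n(1)] B that bih[OF that] by (auto simp: C_def)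
  have lapw: "laplacian w x = 0" if "x \<in> ball 0 1" for x
    using bih[OF that] by (simp add: w_def)
  \<comment> \<open>The admissible pairs are (0,1), (0,2), (1,3), (2,3). The member from {1, 2} will
    give \<open>C = 0\<close>, the member from {0, 3} will give \<open>w = 0\<close>.\<close>
  have ops: "(i = 1 \<or> i = 2 \<or> j = 1 \<or> j = 2) \<and> (i = 0 \<or> j = 3)"
    using ij by auto
  have op: "bdry_op n 0 = bdry_op0 n" "bdry_op n 1 = bdry_op1 n" "bdry_op n 2 = bdry_op2 n" "bdry_op n 3 = bdry_op3 n"
    by (simp_all add: bdry_op_def)
  have C0: "C x = 0" if x: "x \<in> cball 0 1" for x
  proof -
    consider (one) "\<And>y. y \<in> sphere 0 1 \<Longrightarrow> bdry_op1 n U y = 0"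
      | (two) "\<And>y. y \<in> sphere 0 1 \<Longrightarrow> bdry_op2 n U y = 0"
      using ops bi bj op by metis
    then show ?thesis
    proof cases
      case one
      then have "C y = 0" if "y \<in> sphere 0 1" for y
        using bdry_op1_eq[of y n U] that by (simp add: C_def)
      then show ?thesis
        by (intro harmonic_dirichlet_zero[OF cont[OF sm(1)] smooth_on_subset[OF sm(1) B] lapC _ x])
    next
      case two
      have "euler C y + (real n - 1) / 2 * C y = 0" if "y \<in> sphere 0 1" for y
        using two[OF that] bdry_op2_eq[OF V(1,2) _ _ n(1), of y] that S
        by (auto simp: C_def field_simps)
      then show ?thesis
        using n(2) by (intro harmonic_robin_zero[OF V(1) sm(1) V(3) _ lapC _ x, where a = "(real n - 1) / 2"]) auto
    qed
  qed
  \<comment> \<open>\<open>C\<close> is known to vanish on the closed ball only, so its derivatives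
    on the sphere are obtained as limits from inside.\<close>
  have EC0: "euler C x = 0" if x: "x \<in> cball 0 1" for x
  proof (rule zero_on_cball_if_zero_on_ball[OF cont[OF sm(3)] _ x])
    fix y :: 'a assume y: "y \<in> ball 0 1"
    have "euler C y = euler (\<lambda>_. 0) y"
      by (rule euler_cong[OF open_ball y]) (simp add: C0)
    then show "euler C y = 0" by simp
  qed
  have EEC0: "euler (euler C) x = 0" if x: "x \<in> cball 0 1" for x
  proof (rule zero_on_cball_if_zero_on_ball[OF cont[OF sm(4)] _ x])
    fix y :: 'a assume y: "y \<in> ball 0 1"
    have "euler (euler C) y = euler (\<lambda>_. 0) y"
      by (rule euler_cong[OF open_ball y]) (simp add: EC0)
    then show "euler (euler C) y = 0" by simp
  qed
  consider (zero) "\<And>y. y \<in> sphere 0 1 \<Longrightarrow> U y = 0"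
    | (three) "\<And>y. y \<in> sphere 0 1 \<Longrightarrow> bdry_op3 n U y = 0"
    using ops bi bj op unfolding bdry_op0_def[abs_def] by metis
  then show ?thesis
  proof cases
    case zero
    \<comment> \<open>\<open>U\<close> vanishes on the sphere, so its spherical Laplacian does too,
      and \<open>C = 0\<close> gives \<open>euler U y = 0\<close>. Then \<open>w y\<close> equals
      \<open>euler (euler U) y\<close>, while \<open>euler C y = 0\<close> makes it twice that
      value.\<close>
    have w0: "w y = 0" if y: "y \<in> sphere 0 1" for y
    proof -
      have yV: "y \<in> V" and ny: "norm y = 1" and yc: "y \<in> cball 0 1" using y S by auto
      have "sphere_laplacian U y = laplacian (\<lambda>_. 0) y"
        unfolding sphere_laplacian_def
        by (rule laplacian_cong[of "- {0}"]) (use ny in \<open>auto simp: norm_sgn intro!: zero\<close>)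
      then have "w y = euler (euler U) y + (real n - 1) * euler U y"
        using sphere_laplacian_eq[OF V(1,2) yV ny] n(1) by (simp add: w_def)
      moreover have "euler U y = 0"
        using C0[OF yc] zero[OF y] ny[unfolded norm_eq_1] by (simp add: C_def conformal_op_def)
      moreover have "- 2 * w y + 4 * euler (euler U) y + 2 * (real n - 3) * euler U y = 0"
        using EC0[OF yc] ny[unfolded norm_eq_1]
        by (simp add: C_def euler_conformal_op[OF V(1,2) yV] w_def)
      ultimately show ?thesis by simp
    qed
    have "w x = 0" if x: "x \<in> cball 0 1" for x
      by (rule harmonic_dirichlet_zero[OF cont[OF sm(2)] smooth_on_subset[OF sm(2) B] lapw w0 x])
    then have "laplacian U x = 0" if "x \<in> ball 0 1" for x using that by (simp add: w_def)
    then show ?thesis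
      by (intro harmonic_dirichlet_zero[OF cont[OF V(2)] smooth_on_subset[OF V(2) B] _ zero z])
  next
    case three
    have "euler w y + (real n - 1) / 2 * w y = 0" if y: "y \<in> sphere 0 1" for y
    proof -
      have yV: "y \<in> V" and ny: "norm y = 1" and yc: "y \<in> cball 0 1" using y S by auto
      show ?thesis
        using three[OF y] C0[OF yc] EC0[OF yc] EEC0[OF yc]
        unfolding bdry_op3_eq[OF V(1,2) yV ny n(1)] C_def[symmetric] w_def[symmetric] by simp
    qed
    then have w0: "w x = 0" if x: "x \<in> cball 0 1" for x
      using n(2) by (intro harmonic_robin_zero[OF V(1) sm(2) V(3) _ lapw _ x, where a = "(real n - 1) / 2"]) auto
    \<comment> \<open>With \<open>w = 0\<close> the equation \<open>C = 0\<close> loses its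
      second-order term and becomes a first-order equation along the rays, valid in the whole closed
      ball.\<close>
    have EU: "euler U x + (real n - 3) / 2 * U x = 0" if x: "x \<in> cball 0 1" for x
      using C0[OF x] w0[OF x] by (simp add: C_def conformal_op_def w_def field_simps)
    show ?thesis
    proof (cases "n = 2")
      case False
      then show ?thesis
        using n by (intro euler_robin_zero[OF diff[OF V(2)] _ EU z]) auto
    next
      case True
      \<comment> \<open>For \<open>n = 2\<close> the coefficient is -1/2. Differentiating the
        equation and commuting with E raises it by 1, to 1/2, so the sign argument applies to the
        partial derivatives.\<close>
      have grad: "dir_deriv b U x = 0" if x: "x \<in> cball 0 1" for b x
      proof -
        have half: "(0::real) < 1 / 2" by simp
        have smb: "smooth_on (dir_deriv b U) V" using V by (intro smooth_on_dir_deriv)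
        have sum: "smooth_on (\<lambda>x. euler (dir_deriv b U) x + 1 / 2 * dir_deriv b U x) V"
          using V smb by (intro smooth_intros smooth_on_euler)
        show ?thesis
        proof (rule euler_robin_zero[OF diff[OF smb] half _ x])
          fix x :: 'a assume x: "x \<in> cball 0 1"
          show "euler (dir_deriv b U) x + 1 / 2 * dir_deriv b U x = 0"
          proof (rule zero_on_cball_if_zero_on_ball[OF cont[OF sum] _ x])
            fix y :: 'a assume y: "y \<in> ball 0 1"
            have yV: "y \<in> V" and yc: "y \<in> cball 0 1" using y B by auto
            have "dir_deriv b (euler U) y = dir_deriv b (\<lambda>x. 1 / 2 * U x) y"
              using EU True by (intro dir_deriv_cong[OF open_ball y]) force
            also have "\<dots> = 1 / 2 * dir_deriv b U y"
              by (rule dir_deriv_cmult[OF diff[OF V(2) yc]])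
            finally show "euler (dir_deriv b U) y + 1 / 2 * dir_deriv b U y = 0"
              unfolding dir_deriv_euler[OF V(1,2) yV] by simp
          qed
        qed
      qed
      then have "euler U z = 0" using z by (simp add: euler_def)
      then show ?thesis using EU[OF z] True by simp
    qed
  qed
qed

section \<open>Linearity of the boundary operators\<close>

lemma conformal_op_diff:
  assumes V: "open V" "smooth_on f V" "smooth_on g V" "x \<in> V"
  shows "conformal_op n (\<lambda>x. f x - g x) x = conformal_op n f x - conformal_op n g x"
  unfolding conformal_op_def laplacian_diff[OF V]
    euler_diff[OF V(2,3)[THEN smooth_on_imp_differentiable[OF _ V(4)]]]
  by (simp add: algebra_simps)

text \<open>The formulas on the sphere reduce this to the linearity of \<open>conformal_op\<close>,
  \<open>laplacian\<close> and \<open>euler\<close>, so the spherical Laplacian need not be treated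
  separately.\<close>

lemma bdry_op_diff:
  fixes f g :: "'a::euclidean_space \<Rightarrow> real"
  assumes V: "open V" "smooth_on f V" "smooth_on g V" "\<xi> \<in> V" and \<xi>: "norm \<xi> = 1"
    and n: "DIM('a) = n + 1" and i: "i \<le> 3"
  shows "bdry_op n i (\<lambda>x. f x - g x) \<xi> = bdry_op n i f \<xi> - bdry_op n i g \<xi>"
proof -
  let ?h = "\<lambda>x. f x - g x"
  have h: "smooth_on ?h V" using V by (intro smooth_on_diff)
  have d: "F differentiable (at x)" if "smooth_on F V" "x \<in> V" for F x
    using that by (rule smooth_on_imp_differentiable)
  have smC: "smooth_on (conformal_op n F) V" if "smooth_on F V" for F
    using V(1) that by (rule smooth_on_conformal_op)
  have smE: "smooth_on (euler F) V" if "smooth_on F V" for F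
    using V(1) that by (rule smooth_on_euler)
  have smL: "smooth_on (laplacian F) V" if "smooth_on F V" for F
    using V(1) that by (rule smooth_on_laplacian)
  have C: "conformal_op n ?h x = conformal_op n f x - conformal_op n g x" if "x \<in> V" for x
    by (rule conformal_op_diff[OF V(1-3) that])
  have EC: "euler (conformal_op n ?h) x = euler (conformal_op n f) x - euler (conformal_op n g) x"
    if x: "x \<in> V" for x
    using euler_cong[OF V(1) x C] euler_diff[OF d[OF smC[OF V(2)] x] d[OF smC[OF V(3)] x]] by simp
  have EEC: "euler (euler (conformal_op n ?h)) x
      = euler (euler (conformal_op n f)) x - euler (euler (conformal_op n g)) x" if x: "x \<in> V" for x
    using euler_cong[OF V(1) x EC] euler_diff[OF d[OF smE[OF smC[OF V(2)]] x] d[OF smE[OF smC[OF V(3)]] x]]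
    by simp
  have L: "laplacian ?h x = laplacian f x - laplacian g x" if "x \<in> V" for x
    by (rule laplacian_diff[OF V(1-3) that])
  have EL: "euler (laplacian ?h) x = euler (laplacian f) x - euler (laplacian g) x" if x: "x \<in> V" for x
    using euler_cong[OF V(1) x L] euler_diff[OF d[OF smL[OF V(2)] x] d[OF smL[OF V(3)] x]] by simp
  note eqs = C[OF V(4)] EC[OF V(4)] EEC[OF V(4)] L[OF V(4)] EL[OF V(4)]
  consider "i = 0" | "i = 1" | "i = 2" | "i = 3" using i by linarith
  then show ?thesis
  proof cases
    case 1
    then show ?thesis by (simp add: bdry_op_def bdry_op0_def)
  next
    case 2
    then show ?thesis by (simp add: bdry_op_def bdry_op1_eq[OF \<xi>] eqs diff_divide_distrib)
  next
    case 3
    then show ?thesis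
      by (simp add: bdry_op_def bdry_op2_eq[OF V(1) h V(4) \<xi> n] bdry_op2_eq[OF V(1,2,4) \<xi> n]
          bdry_op2_eq[OF V(1,3,4) \<xi> n] eqs algebra_simps diff_divide_distrib)
  next
    case 4
    then show ?thesis
      by (simp add: bdry_op_def bdry_op3_eq[OF V(1) h V(4) \<xi> n] bdry_op3_eq[OF V(1,2,4) \<xi> n]
          bdry_op3_eq[OF V(1,3,4) \<xi> n] eqs algebra_simps diff_divide_distrib)
  qed
qed

section \<open>Squared distances to the pole and to its image\<close>

text \<open>The parameters \<alpha> = 1, \<delta> = |\<eta>|^2 give the squared distance to \<eta>,
  and \<alpha> = |\<eta>|^2, \<delta> = 1 give the square of \<open>refl_dist\<close>. Both satisfy
  \<alpha> \<delta> = |\<eta>|^2, so one computation serves for both.\<close>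

definition quadratic :: "real \<Rightarrow> real \<Rightarrow> 'a::euclidean_space \<Rightarrow> 'a \<Rightarrow> real" where
  "quadratic \<alpha> \<delta> \<eta> x = \<alpha> * (x \<bullet> x) - 2 * (x \<bullet> \<eta>) + \<delta>"

lemma norm_diff_eq_quadratic: "(norm (x - \<eta>))\<^sup>2 = quadratic 1 (\<eta> \<bullet> \<eta>) \<eta> x"
  by (simp add: quadratic_def power2_norm_eq_inner inner_diff_left inner_diff_right
      inner_commute[of \<eta> x])

lemma refl_dist_eq_quadratic: "refl_dist x \<eta> = sqrt (quadratic (\<eta> \<bullet> \<eta>) 1 \<eta> x)"
  by (simp add: refl_dist_def norm_diff_eq_quadratic quadratic_def power2_norm_eq_inner inner_commute
      algebra_simps)

lemma smooth_on_quadratic: "open V \<Longrightarrow> smooth_on (quadratic \<alpha> \<delta> \<eta>) V"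
  unfolding quadratic_def[abs_def] by (intro smooth_intros)

definition fund_const :: "nat \<Rightarrow> real" where
  "fund_const n = 1 / (2 * (real n - 1) * (real n - 3) * sphere_area n)"

lemma fund_sol_sqrt:
  assumes "q \<ge> 0" "n \<ge> 2" "n \<noteq> 3"
  shows "fund_sol n (sqrt q) = fund_const n * q powr ((3 - real n) / 2)"
\<comment> \<open>At 0 both sides are 0: the exponent \<open>3 - int n\<close> is not 0, and for
  negative exponents \<open>powi\<close> and \<open>powr\<close> return 0 there by
  convention.\<close>
proof (cases "q = 0")
  case True
  then show ?thesis using assms by (simp add: fund_sol_def)
next
  case False
  then have "sqrt q powi (3 - int n) = sqrt q powr real_of_int (3 - int n)"
    using assms by (subst powr_real_of_int') auto
  also have "\<dots> = q powr ((3 - real n) / 2)"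
    using assms by (simp add: powr_half_sqrt[symmetric] powr_powr)
  finally show ?thesis by (simp add: fund_sol_def fund_const_def)
qed

lemma fund_sol_norm:
  assumes "n \<ge> 2" "n \<noteq> 3"
  shows "fund_sol n (norm (x - \<eta>)) = fund_const n * quadratic 1 (\<eta> \<bullet> \<eta>) \<eta> x powr ((3 - real n) / 2)"
proof -
  have "norm (x - \<eta>) = sqrt (quadratic 1 (\<eta> \<bullet> \<eta>) \<eta> x)"
    by (simp flip: norm_diff_eq_quadratic)
  moreover have "quadratic 1 (\<eta> \<bullet> \<eta>) \<eta> x \<ge> 0"
    by (simp flip: norm_diff_eq_quadratic)
  ultimately show ?thesis using fund_sol_sqrt[OF _ assms] by simp
qed

lemma quadratic_norm_pos: "x \<noteq> \<eta> \<Longrightarrow> quadratic 1 (\<eta> \<bullet> \<eta>) \<eta> x > 0"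
  by (simp flip: norm_diff_eq_quadratic)

lemma smooth_on_fund_sol:
  assumes "n \<ge> 2" "n \<noteq> 3"
  shows "smooth_on (\<lambda>x. fund_sol n (norm (x - \<eta>))) (- {\<eta>})"
  unfolding fund_sol_norm[OF assms]
  by (intro smooth_intros smooth_on_powr smooth_on_quadratic quadratic_norm_pos) auto

section \<open>Uniqueness of the Green functions\<close>

text \<open>The fundamental solution cancels in the difference, which leaves a biharmonic function
  that is smooth up to the sphere and satisfies both homogeneous boundary conditions. The equality
  includes \<xi> = \<eta>, as the singular summands are identical.\<close>

lemma is_green_unique:
  fixes G G' :: "'a::euclidean_space \<Rightarrow> 'a \<Rightarrow> ereal"
  assumes n: "DIM('a) = n + 1" "n \<ge> 2" "n \<noteq> 3"
    and G: "is_green n i j G" and G': "is_green n i j G'"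
    and \<xi>: "\<xi> \<in> cball 0 1" and \<eta>: "\<eta> \<in> ball 0 1"
  shows "G \<xi> \<eta> = G' \<xi> \<eta>"
proof -
  let ?\<Phi> = "\<lambda>x. fund_sol n (norm (x - \<eta>))"
  obtain V H where H: "open V" "cball 0 1 \<subseteq> V" "smooth_on H V"
      "\<forall>\<xi>\<in>cball 0 1. G \<xi> \<eta> = fund_sol_ext n (norm (\<xi> - \<eta>)) + ereal (H \<xi>)"
      "\<forall>\<xi>\<in>ball 0 1. laplacian (laplacian H) \<xi> = 0"
      "\<forall>\<xi>\<in>sphere 0 1. bdry_op n i (\<lambda>x. ?\<Phi> x + H x) \<xi> = 0"
      "\<forall>\<xi>\<in>sphere 0 1. bdry_op n j (\<lambda>x. ?\<Phi> x + H x) \<xi> = 0"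
    using bspec[OF G[unfolded is_green_def, THEN conjunct2, THEN conjunct2, THEN conjunct2,
        THEN conjunct2] \<eta>]
    by (elim exE conjE) (rule that)
  obtain V' H' where H': "open V'" "cball 0 1 \<subseteq> V'" "smooth_on H' V'"
      "\<forall>\<xi>\<in>cball 0 1. G' \<xi> \<eta> = fund_sol_ext n (norm (\<xi> - \<eta>)) + ereal (H' \<xi>)"
      "\<forall>\<xi>\<in>ball 0 1. laplacian (laplacian H') \<xi> = 0"
      "\<forall>\<xi>\<in>sphere 0 1. bdry_op n i (\<lambda>x. ?\<Phi> x + H' x) \<xi> = 0"
      "\<forall>\<xi>\<in>sphere 0 1. bdry_op n j (\<lambda>x. ?\<Phi> x + H' x) \<xi> = 0"
    using bspec[OF G'[unfolded is_green_def, THEN conjunct2, THEN conjunct2, THEN conjunct2,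
        THEN conjunct2] \<eta>]
    by (elim exE conjE) (rule that)
  have ij: "i < j" "j \<le> 3" "i + j \<noteq> 3" using G by (auto simp: is_green_def)
  define W where "W = V \<inter> V'"
  have W: "open W" "cball 0 1 \<subseteq> W" using H H' by (auto simp: W_def)
  have sm: "smooth_on H W" "smooth_on H' W"
    unfolding W_def by (rule smooth_on_subset[OF H(3)] smooth_on_subset[OF H'(3)], blast)+
  have smD: "smooth_on (\<lambda>x. H x - H' x) W" using W sm by (intro smooth_on_diff)
  have bd: "bdry_op n k (\<lambda>x. H x - H' x) x = 0"
    if k: "k \<le> 3" "bdry_op n k (\<lambda>x. ?\<Phi> x + H x) x = 0" "bdry_op n k (\<lambda>x. ?\<Phi> x + H' x) x = 0"
      and x: "x \<in> sphere 0 1" for k x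
  proof -
    \<comment> \<open>The boundary conditions concern sums with the fundamental solution, which is
      smooth off \<open>\<eta>\<close>. As \<open>\<eta>\<close> is an interior point, removing it
      keeps a neighbourhood of the sphere.\<close>
    have o: "open (W \<inter> - {\<eta>})" using W by auto
    have xo: "x \<in> W \<inter> - {\<eta>}" using x \<eta> W by auto
    have s\<Phi>: "smooth_on ?\<Phi> (W \<inter> - {\<eta>})"
      by (rule smooth_on_subset[OF smooth_on_fund_sol[OF n(2,3)]]) simp
    have "bdry_op n k (\<lambda>x. (?\<Phi> x + H x) - (?\<Phi> x + H' x)) x
        = bdry_op n k (\<lambda>x. ?\<Phi> x + H x) x - bdry_op n k (\<lambda>x. ?\<Phi> x + H' x) x"
      using x
      by (intro bdry_op_diff[OF o _ _ xo _ n(1) k(1)] smooth_on_add[OF o s\<Phi>]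
          smooth_on_subset[OF sm(1)] smooth_on_subset[OF sm(2)]) auto
    then show ?thesis using k by simp
  qed
  have "H \<xi> - H' \<xi> = 0"
  proof (rule biharmonic_unique[OF W(1) smD W(2) n ij _ _ _ \<xi>])
    fix x :: 'a assume x: "x \<in> ball 0 1"
    then have xW: "x \<in> W" using W by auto
    have "laplacian (laplacian (\<lambda>x. H x - H' x)) x = laplacian (\<lambda>x. laplacian H x - laplacian H' x) x"
      by (rule laplacian_cong[OF W(1) xW]) (rule laplacian_diff[OF W(1) sm])
    also have "\<dots> = 0"
      using laplacian_diff[OF W(1) sm[THEN smooth_on_laplacian[OF W(1)]] xW] H(5) H'(5) x by simp
    finally show "laplacian (laplacian (\<lambda>x. H x - H' x)) x = 0" .
  next
    fix x :: 'a assume x: "x \<in> sphere 0 1"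
    show "bdry_op n i (\<lambda>x. H x - H' x) x = 0"
      using bd[of i x] ij H(6) H'(6) x by simp
    show "bdry_op n j (\<lambda>x. H x - H' x) x = 0"
      using bd[of j x] ij H(7) H'(7) x by simp
  qed
  then show ?thesis using H(4) H'(4) \<xi> by simp
qed

subsection \<open>The explicit kernels\<close>

lemma dir_deriv_quadratic: "dir_deriv v (quadratic \<alpha> \<delta> \<eta>) x = 2 * \<alpha> * (x \<bullet> v) - 2 * (v \<bullet> \<eta>)"
  unfolding quadratic_def[abs_def]
  by (rule dir_deriv_unique) (auto intro!: derivative_eq_intros simp: inner_commute)

lemma euler_quadratic: "euler (quadratic \<alpha> \<delta> \<eta>) x = 2 * (\<alpha> * (x \<bullet> x) - x \<bullet> \<eta>)"
  by (simp add: euler_def dir_deriv_quadratic)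

lemma laplacian_quadratic:
  "laplacian (quadratic \<alpha> \<delta> \<eta>) (x::'a::euclidean_space) = 2 * \<alpha> * real DIM('a)"
proof -
  have "dir_deriv b (quadratic \<alpha> \<delta> \<eta>) = (\<lambda>x. 2 * \<alpha> * (x \<bullet> b) - 2 * (b \<bullet> \<eta>))" for b :: 'a
    by (rule ext) (rule dir_deriv_quadratic)
  moreover have "dir_deriv b (\<lambda>x. 2 * \<alpha> * (x \<bullet> b) - 2 * (b \<bullet> \<eta>)) x = 2 * \<alpha> * (b \<bullet> b)" for b
    by (rule dir_deriv_unique) (auto intro!: derivative_eq_intros)
  ultimately show ?thesis by (simp add: laplacian_def)
qed

text \<open>Half the gradient is \<alpha> x - \<eta>. Its squared norm is \<alpha> times the
  quadratic precisely because of the relation between \<alpha>, \<delta> and \<eta>.\<close>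

lemma gradient_quadratic:
  assumes "\<alpha> * \<delta> = \<eta> \<bullet> \<eta>"
  shows "(\<Sum>b\<in>Basis. (dir_deriv b (quadratic \<alpha> \<delta> \<eta>) x)\<^sup>2) = 4 * \<alpha> * quadratic \<alpha> \<delta> \<eta> x"
proof -
  have "(\<Sum>b\<in>Basis. (dir_deriv b (quadratic \<alpha> \<delta> \<eta>) x)\<^sup>2)
      = (\<Sum>b\<in>Basis. 4 * (((\<alpha> *\<^sub>R x - \<eta>) \<bullet> b) * ((\<alpha> *\<^sub>R x - \<eta>) \<bullet> b)))"
    by (intro sum.cong refl)
      (simp add: dir_deriv_quadratic power2_eq_square inner_diff_left inner_commute[of \<eta>]
        algebra_simps)
  also have "\<dots> = 4 * ((\<alpha> *\<^sub>R x - \<eta>) \<bullet> (\<alpha> *\<^sub>R x - \<eta>))"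
    by (subst (3) euclidean_inner) (simp only: sum_distrib_left)
  also have "\<dots> = 4 * (\<alpha> * \<alpha> * (x \<bullet> x) - 2 * \<alpha> * (x \<bullet> \<eta>) + \<eta> \<bullet> \<eta>)"
    by (simp add: inner_diff_left inner_diff_right inner_commute[of \<eta> x] algebra_simps)
  also have "\<dots> = 4 * \<alpha> * quadratic \<alpha> \<delta> \<eta> x"
    unfolding quadratic_def assms[symmetric] by (simp add: algebra_simps)
  finally show ?thesis .
qed

lemma differentiable_quadratic: "quadratic \<alpha> \<delta> \<eta> differentiable (at x)"
  using smooth_on_imp_differentiable[OF smooth_on_quadratic[OF open_UNIV] UNIV_I] .

lemma euler_quadratic_powr:
  assumes "quadratic \<alpha> \<delta> \<eta> x > 0"
  shows "euler (\<lambda>x. quadratic \<alpha> \<delta> \<eta> x powr m) x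
    = m * quadratic \<alpha> \<delta> \<eta> x powr (m - 1) * (2 * (\<alpha> * (x \<bullet> x) - x \<bullet> \<eta>))"
  using euler_powr[OF differentiable_quadratic assms] by (simp add: euler_quadratic)

lemma smooth_on_quadratic_powr:
  assumes "open V" "\<forall>y\<in>V. quadratic \<alpha> \<delta> \<eta> y > 0"
  shows "smooth_on (\<lambda>x. quadratic \<alpha> \<delta> \<eta> x powr m) V"
  using assms by (intro smooth_on_powr smooth_on_quadratic) auto

text \<open>The squared gradient is a multiple of the quadratic, so both terms of the chain rule
  merge into one power. The coefficient vanishes for the harmonic exponent
  \<open>m = (2 - DIM('a)) / 2\<close>.\<close>

lemma laplacian_quadratic_powr:
  fixes x :: "'a::euclidean_space"
  assumes V: "open V" "x \<in> V" and pos: "\<forall>y\<in>V. quadratic \<alpha> \<delta> \<eta> y > 0"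
    and c: "\<alpha> * \<delta> = \<eta> \<bullet> \<eta>"
  shows "laplacian (\<lambda>x. quadratic \<alpha> \<delta> \<eta> x powr m) x
    = 2 * m * \<alpha> * (real DIM('a) - 2 + 2 * m) * quadratic \<alpha> \<delta> \<eta> x powr (m - 1)"
proof -
  have "quadratic \<alpha> \<delta> \<eta> x powr (m - 1) = quadratic \<alpha> \<delta> \<eta> x powr (m - 2) * quadratic \<alpha> \<delta> \<eta> x"
    using bspec[OF pos V(2)] powr_add[of "quadratic \<alpha> \<delta> \<eta> x" "m - 2" 1] by simp
  moreover have "laplacian (\<lambda>x. quadratic \<alpha> \<delta> \<eta> x powr m) x
      = m * quadratic \<alpha> \<delta> \<eta> x powr (m - 1) * laplacian (quadratic \<alpha> \<delta> \<eta>) x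
        + m * (m - 1) * quadratic \<alpha> \<delta> \<eta> x powr (m - 2)
          * (\<Sum>b\<in>Basis. (dir_deriv b (quadratic \<alpha> \<delta> \<eta>) x)\<^sup>2)"
    using pos by (intro laplacian_powr[OF V(1) smooth_on_quadratic[OF V(1)] V(2)]) auto
  ultimately show ?thesis
    unfolding gradient_quadratic[OF c] laplacian_quadratic
    by (simp add: algebra_simps)
qed

lemma conformal_op_add:
  assumes V: "open V" "smooth_on f V" "smooth_on g V" "x \<in> V"
  shows "conformal_op n (\<lambda>x. f x + g x) x = conformal_op n f x + conformal_op n g x"
  unfolding conformal_op_def laplacian_add[OF V]
    euler_add[OF V(2,3)[THEN smooth_on_imp_differentiable[OF _ V(4)]]]
  by (simp add: algebra_simps)

lemma conformal_op_cmult: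
  assumes V: "open V" "smooth_on f V" "x \<in> V"
  shows "conformal_op n (\<lambda>x. c * f x) x = c * conformal_op n f x"
  unfolding conformal_op_def laplacian_cmult[OF V]
    euler_cmult[OF V(2)[THEN smooth_on_imp_differentiable[OF _ V(3)]]]
  by (simp add: algebra_simps)

text \<open>After a common power is factored out, the dependence on \<open>x\<close> cancels and the
  constant \<alpha> - \<delta> remains. It has opposite signs for the pole and for the
  image.\<close>

lemma conformal_op_quadratic_powr:
  fixes x :: "'a::euclidean_space"
  assumes V: "open V" "x \<in> V" and pos: "\<forall>y\<in>V. quadratic \<alpha> \<delta> \<eta> y > 0"
    and c: "\<alpha> * \<delta> = \<eta> \<bullet> \<eta>" and n: "DIM('a) = n + 1"
  shows "conformal_op n (\<lambda>x. quadratic \<alpha> \<delta> \<eta> x powr ((3 - real n) / 2)) x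
    = 2 * (3 - real n) * (\<alpha> - \<delta>) * quadratic \<alpha> \<delta> \<eta> x powr ((1 - real n) / 2)"
proof -
  define q where "q = quadratic \<alpha> \<delta> \<eta> x"
  define Q where "Q = q powr ((1 - real n) / 2)"
  have e: "(3 - real n) / 2 - 1 = (1 - real n) / 2" by (simp add: field_simps)
  have e2: "(3 - real n) / 2 = (1 - real n) / 2 + 1" by (simp add: field_simps)
  have "q powr ((3 - real n) / 2) = Q * q"
    unfolding e2 powr_add Q_def using bspec[OF pos V(2)] by (simp add: q_def)
  then have "conformal_op n (\<lambda>x. quadratic \<alpha> \<delta> \<eta> x powr ((3 - real n) / 2)) x
      = 2 * (3 - real n) * Q * ((1 - x \<bullet> x) * \<alpha> + 2 * (\<alpha> * (x \<bullet> x) - x \<bullet> \<eta>) - q)"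
    unfolding conformal_op_def laplacian_quadratic_powr[OF V pos c] euler_quadratic_powr[OF bspec[OF pos V(2)]]
      e q_def[symmetric] Q_def[symmetric] n by (simp add: field_simps)
  also have "(1 - x \<bullet> x) * \<alpha> + 2 * (\<alpha> * (x \<bullet> x) - x \<bullet> \<eta>) - q = \<alpha> - \<delta>"
    by (simp add: q_def quadratic_def algebra_simps)
  finally show ?thesis by (simp add: q_def Q_def)
qed

lemma laplacian_quadratic_powr_biharmonic:
  fixes x :: "'a::euclidean_space"
  assumes V: "open V" "x \<in> V" and pos: "\<forall>y\<in>V. quadratic \<alpha> \<delta> \<eta> y > 0"
    and c: "\<alpha> * \<delta> = \<eta> \<bullet> \<eta>" and n: "DIM('a) = n + 1"
  shows "laplacian (\<lambda>x. quadratic \<alpha> \<delta> \<eta> x powr ((3 - real n) / 2)) x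
    = 2 * (3 - real n) * \<alpha> * quadratic \<alpha> \<delta> \<eta> x powr ((1 - real n) / 2)"
proof -
  have e: "(3 - real n) / 2 - 1 = (1 - real n) / 2" by (simp add: field_simps)
  show ?thesis
    unfolding laplacian_quadratic_powr[OF V pos c] e n by (simp add: field_simps)
qed

lemma laplacian_quadratic_powr_harmonic:
  fixes x :: "'a::euclidean_space"
  assumes V: "open V" "x \<in> V" and pos: "\<forall>y\<in>V. quadratic \<alpha> \<delta> \<eta> y > 0"
    and c: "\<alpha> * \<delta> = \<eta> \<bullet> \<eta>" and n: "DIM('a) = n + 1"
  shows "laplacian (\<lambda>x. quadratic \<alpha> \<delta> \<eta> x powr ((1 - real n) / 2)) x = 0"
proof -
  have "real (n + 1) - 2 + 2 * ((1 - real n) / 2) = 0" by (simp add: field_simps)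
  then show ?thesis unfolding laplacian_quadratic_powr[OF V pos c] n by simp
qed

text \<open>The terms with \<open>euler f\<close> cancel, and -8 (1 - |x|^2) f - 8 |x|^2 f
  remains.\<close>

lemma conformal_op_one_minus_mult:
  fixes f :: "'a::euclidean_space \<Rightarrow> real"
  assumes V: "open V" "smooth_on f V" "x \<in> V" and lap: "laplacian f x = 0" and n: "DIM('a) = n + 1"
  shows "conformal_op n (\<lambda>x. (1 - x \<bullet> x) * f x) x = - 8 * f x"
proof -
  have f: "f differentiable (at x)" using smooth_on_imp_differentiable V(2,3) .
  have D: "((\<lambda>x. (1 - x \<bullet> x) * f x) has_derivative
      (\<lambda>v. (1 - x \<bullet> x) * dir_deriv v f x - 2 * (x \<bullet> v) * f x)) (at x)"
    by (auto intro!: derivative_eq_intros has_derivative_dir_deriv[OF f] simp: inner_commute algebra_simps)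
  have "euler (\<lambda>x. (1 - x \<bullet> x) * f x) x = (1 - x \<bullet> x) * euler f x - 2 * (x \<bullet> x) * f x"
    unfolding euler_def[of "\<lambda>x. (1 - x \<bullet> x) * f x"] dir_deriv_unique[OF D] by (simp add: euler_def)
  then show ?thesis
    unfolding conformal_op_def laplacian_one_minus_mult[OF V] lap n by (simp add: algebra_simps)
qed

text \<open>The quadratic is |x - \<eta>|^2 + (1 - |x|^2)(1 - |\<eta>|^2): off \<eta> the first term
  is positive, and at \<eta> the second. Hence powers of it are smooth in a neighbourhood of the
  closed ball.\<close>

lemma quadratic_image_pos:
  assumes "\<eta> \<in> ball 0 1" "x \<in> cball 0 1"
  shows "quadratic (\<eta> \<bullet> \<eta>) 1 \<eta> x > 0"
proof -
  have "norm \<eta> < 1" "norm x \<le> 1" using assms by auto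
  then have "\<eta> \<bullet> \<eta> < 1" "x \<bullet> x \<le> 1"
    by (simp_all add: dot_square_norm power_less_one_iff power_le_one_iff abs_square_less_1)
  have eq: "quadratic (\<eta> \<bullet> \<eta>) 1 \<eta> x = (norm (x - \<eta>))\<^sup>2 + (1 - x \<bullet> x) * (1 - \<eta> \<bullet> \<eta>)"
    unfolding norm_diff_eq_quadratic by (simp add: quadratic_def algebra_simps)
  show ?thesis
  proof (cases "x = \<eta>")
    case True
    then show ?thesis using eq \<open>\<eta> \<bullet> \<eta> < 1\<close> by simp
  next
    case False
    then have "(norm (x - \<eta>))\<^sup>2 > 0" by simp
    moreover have "(1 - x \<bullet> x) * (1 - \<eta> \<bullet> \<eta>) \<ge> 0"
      using \<open>\<eta> \<bullet> \<eta> < 1\<close> \<open>x \<bullet> x \<le> 1\<close> by simp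
    ultimately show ?thesis using eq by linarith
  qed
qed

section \<open>The harmonic kernels of the pole and of its image\<close>

definition pole_kernel :: "nat \<Rightarrow> 'a::euclidean_space \<Rightarrow> 'a \<Rightarrow> real" where
  "pole_kernel n \<eta> x = quadratic 1 (\<eta> \<bullet> \<eta>) \<eta> x powr ((1 - real n) / 2)"

text \<open>The Kelvin transform Q of the introduction. The form through \<open>quadratic\<close>
  includes the origin, where the inversion is undefined.\<close>

definition image_kernel :: "nat \<Rightarrow> 'a::euclidean_space \<Rightarrow> 'a \<Rightarrow> real" where
  "image_kernel n \<eta> x = quadratic (\<eta> \<bullet> \<eta>) 1 \<eta> x powr ((1 - real n) / 2)"

lemma euler_euler_quadratic_powr:
  assumes V: "open V" "x \<in> V" and pos: "\<forall>y\<in>V. quadratic \<alpha> \<delta> \<eta> y > 0"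
  shows "euler (euler (\<lambda>x. quadratic \<alpha> \<delta> \<eta> x powr m)) x
    = m * (m - 1) * quadratic \<alpha> \<delta> \<eta> x powr (m - 2) * (2 * (\<alpha> * (x \<bullet> x) - x \<bullet> \<eta>))\<^sup>2
      + m * quadratic \<alpha> \<delta> \<eta> x powr (m - 1) * (4 * \<alpha> * (x \<bullet> x) - 2 * (x \<bullet> \<eta>))"
proof -
  let ?g = "\<lambda>x. 2 * (\<alpha> * (x \<bullet> x) - x \<bullet> \<eta>)"
  have "smooth_on (\<lambda>x. quadratic \<alpha> \<delta> \<eta> x powr (m - 1)) V"
    using smooth_on_quadratic_powr[OF V(1) pos] .
  then have d: "(\<lambda>x. quadratic \<alpha> \<delta> \<eta> x powr (m - 1)) differentiable (at x)"
    using V(2) by (rule smooth_on_imp_differentiable)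
  have "smooth_on ?g V" using V(1) by (intro smooth_intros)
  then have g: "?g differentiable (at x)"
    using V(2) by (rule smooth_on_imp_differentiable)
  have Eg: "euler ?g x = 4 * \<alpha> * (x \<bullet> x) - 2 * (x \<bullet> \<eta>)"
    unfolding euler_def
    by (subst dir_deriv_unique[where f' = "\<lambda>v. 4 * \<alpha> * (x \<bullet> v) - 2 * (v \<bullet> \<eta>)"])
      (auto intro!: derivative_eq_intros simp: inner_commute algebra_simps)
  have "euler (euler (\<lambda>x. quadratic \<alpha> \<delta> \<eta> x powr m)) x
      = euler (\<lambda>x. m * (quadratic \<alpha> \<delta> \<eta> x powr (m - 1) * ?g x)) x"
    using pos by (intro euler_cong[OF V]) (simp add: euler_quadratic_powr)
  also have "\<dots> = m * (quadratic \<alpha> \<delta> \<eta> x powr (m - 1) * euler ?g x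
      + euler (\<lambda>x. quadratic \<alpha> \<delta> \<eta> x powr (m - 1)) x * ?g x)"
    by (subst euler_cmult[OF differentiable_mult[OF d g]], subst euler_mult[OF d g]) simp
  finally show ?thesis
    unfolding Eg euler_quadratic_powr[OF bspec[OF pos V(2)]]
    by (simp add: algebra_simps power2_eq_square)
qed

text \<open>With D = E + (n - 1) / 2 these are P = Q, D P = - D Q and D D P = D D Q on the sphere.
  There both quadratics take the same value \<open>A\<close>, and their images under E add up to
  \<open>2 * A\<close>.\<close>

lemma kernels_on_sphere:
  assumes \<eta>: "\<eta> \<in> ball 0 1" and \<xi>: "norm \<xi> = 1"
  shows "pole_kernel n \<eta> \<xi> = image_kernel n \<eta> \<xi>"
    and "euler (pole_kernel n \<eta>) \<xi> + euler (image_kernel n \<eta>) \<xi> = - (real n - 1) * image_kernel n \<eta> \<xi>"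
    and "euler (euler (pole_kernel n \<eta>)) \<xi> + (real n - 1) * euler (pole_kernel n \<eta>) \<xi>
      = euler (euler (image_kernel n \<eta>)) \<xi> + (real n - 1) * euler (image_kernel n \<eta>) \<xi>"
proof -
  define p where "p = (1 - real n) / 2"
  define A where "A = 1 - 2 * (\<xi> \<bullet> \<eta>) + \<eta> \<bullet> \<eta>"
  define V where "V = - {\<eta>}"
  define V' where "V' = quadratic (\<eta> \<bullet> \<eta>) 1 \<eta> -` {0<..}"
  have xx: "\<xi> \<bullet> \<xi> = 1" using \<xi> by (simp add: norm_eq_1)
  have q: "quadratic 1 (\<eta> \<bullet> \<eta>) \<eta> \<xi> = A" "quadratic (\<eta> \<bullet> \<eta>) 1 \<eta> \<xi> = A"
    by (simp_all add: quadratic_def A_def xx)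
  have V: "open V" "\<xi> \<in> V" using \<eta> \<xi> by (auto simp: V_def)
  have posV: "\<forall>y\<in>V. quadratic 1 (\<eta> \<bullet> \<eta>) \<eta> y > 0"
    by (auto simp: V_def quadratic_norm_pos)
  have "open V'"
    unfolding V'_def quadratic_def by (intro open_vimage open_greaterThan continuous_intros)
  moreover have A: "A > 0" using bspec[OF posV V(2)] q by simp
  ultimately have V': "open V'" "\<xi> \<in> V'" using q by (auto simp: V'_def)
  have posV': "\<forall>y\<in>V'. quadratic (\<eta> \<bullet> \<eta>) 1 \<eta> y > 0" by (simp add: V'_def)
  have fn: "pole_kernel n \<eta> = (\<lambda>x. quadratic 1 (\<eta> \<bullet> \<eta>) \<eta> x powr p)"
    "image_kernel n \<eta> = (\<lambda>x. quadratic (\<eta> \<bullet> \<eta>) 1 \<eta> x powr p)"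
    by (simp_all add: fun_eq_iff pole_kernel_def image_kernel_def p_def)
  show "pole_kernel n \<eta> \<xi> = image_kernel n \<eta> \<xi>" by (simp add: fn q)
  \<comment> \<open>The lowest power that occurs; the other powers are \<open>R * A\<close> and
    \<open>R * A * A\<close>, so that the identities become polynomial.\<close>
  define R where "R = A powr (p - 2)"
  have R1: "A powr (p - 1) = R * A"
    using powr_add[of A "p - 2" 1] A by (simp add: R_def)
  have R2: "A powr p = R * A * A"
    using powr_add[of A "p - 2" 2] A by (simp add: R_def power2_eq_square)
  have n': "real n - 1 = - 2 * p" by (simp add: p_def)
  have EP: "euler (pole_kernel n \<eta>) \<xi> = p * (R * A) * (2 * (1 - \<xi> \<bullet> \<eta>))"
    unfolding fn euler_quadratic_powr[OF bspec[OF posV V(2)]] q xx R1 by simp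
  have EQ: "euler (image_kernel n \<eta>) \<xi> = p * (R * A) * (2 * (\<eta> \<bullet> \<eta> - \<xi> \<bullet> \<eta>))"
    unfolding fn euler_quadratic_powr[OF bspec[OF posV' V'(2)]] q xx R1 by simp
  have EEP: "euler (euler (pole_kernel n \<eta>)) \<xi> = p * (p - 1) * R * (2 * (1 - \<xi> \<bullet> \<eta>))\<^sup>2
      + p * (R * A) * (4 - 2 * (\<xi> \<bullet> \<eta>))"
    unfolding fn euler_euler_quadratic_powr[OF V posV] q xx R1 by (simp add: R_def)
  have EEQ: "euler (euler (image_kernel n \<eta>)) \<xi> = p * (p - 1) * R * (2 * (\<eta> \<bullet> \<eta> - \<xi> \<bullet> \<eta>))\<^sup>2
      + p * (R * A) * (4 * (\<eta> \<bullet> \<eta>) - 2 * (\<xi> \<bullet> \<eta>))"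
    unfolding fn euler_euler_quadratic_powr[OF V' posV'] q xx R1 by (simp add: R_def)
  have "euler (pole_kernel n \<eta>) \<xi> + euler (image_kernel n \<eta>) \<xi> = 2 * p * (R * A) * A"
    unfolding EP EQ by (simp add: A_def algebra_simps)
  then show "euler (pole_kernel n \<eta>) \<xi> + euler (image_kernel n \<eta>) \<xi>
      = - (real n - 1) * image_kernel n \<eta> \<xi>"
    unfolding n' by (simp add: fn q R2)
  \<comment> \<open>A difference of squares: the bases have sum \<open>2 * A\<close> and difference
    2 (1 - |\<eta>|^2). The factor \<open>A\<close> lets both parts of the second derivative
    combine.\<close>
  have sq: "(2 * (1 - \<xi> \<bullet> \<eta>))\<^sup>2 - (2 * (\<eta> \<bullet> \<eta> - \<xi> \<bullet> \<eta>))\<^sup>2 = 4 * (1 - \<eta> \<bullet> \<eta>) * A"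
    by (simp add: A_def power2_eq_square algebra_simps)
  have "euler (euler (pole_kernel n \<eta>)) \<xi> - euler (euler (image_kernel n \<eta>)) \<xi>
      = p * (p - 1) * R * ((2 * (1 - \<xi> \<bullet> \<eta>))\<^sup>2 - (2 * (\<eta> \<bullet> \<eta> - \<xi> \<bullet> \<eta>))\<^sup>2)
        + p * (R * A) * (4 * (1 - \<eta> \<bullet> \<eta>))"
    unfolding EEP EEQ by (simp add: algebra_simps)
  also have "\<dots> = 4 * p * p * (R * A) * (1 - \<eta> \<bullet> \<eta>)"
    unfolding sq by (simp add: algebra_simps)
  also have "\<dots> = - (real n - 1) * (euler (pole_kernel n \<eta>) \<xi> - euler (image_kernel n \<eta>) \<xi>)"
    unfolding n' EP EQ by (simp add: algebra_simps)
  finally show "euler (euler (pole_kernel n \<eta>)) \<xi> + (real n - 1) * euler (pole_kernel n \<eta>) \<xi>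
      = euler (euler (image_kernel n \<eta>)) \<xi> + (real n - 1) * euler (image_kernel n \<eta>) \<xi>"
    by (simp add: algebra_simps)
qed

text \<open>
  The pairs \<open>(a, b)\<close> equal to \<open>(-1, 1)\<close>, \<open>(1, -1)\<close>, \<open>(-1, 0)\<close>, \<open>(1, 0)\<close> give the kernels for the
  boundary conditions \<open>(0, 1)\<close>, \<open>(2, 3)\<close>, \<open>(0, 2)\<close>, \<open>(1, 3)\<close>.
\<close>

definition regular_part :: "nat \<Rightarrow> real \<Rightarrow> real \<Rightarrow> 'a::euclidean_space \<Rightarrow> 'a \<Rightarrow> real" where
  "regular_part n a b \<eta> x =
     a * fund_const n * quadratic (\<eta> \<bullet> \<eta>) 1 \<eta> x powr ((3 - real n) / 2)
     + b * fund_const n * (3 - real n) / 2 * (1 - \<eta> \<bullet> \<eta>) * ((1 - x \<bullet> x) * image_kernel n \<eta> x)"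

text \<open>The first summand is a power of the quadratic, the second
  \<open>1 - x \<bullet> x\<close> times a harmonic function, so the earlier formulas apply.
  \<open>conformal_op\<close> sees only \<open>a + 2 * b\<close>, hence so do the first and second
  boundary operators.\<close>

lemma regular_part_operators:
  fixes \<eta> x :: "'a::euclidean_space"
  assumes V: "open V" "x \<in> V" and pos: "\<forall>y\<in>V. quadratic (\<eta> \<bullet> \<eta>) 1 \<eta> y > 0"
    and n: "DIM('a) = n + 1"
  shows "smooth_on (regular_part n a b \<eta>) V"
    and "laplacian (regular_part n a b \<eta>) x = 2 * fund_const n * (3 - real n)
      * ((a * (\<eta> \<bullet> \<eta>) - b * (1 - \<eta> \<bullet> \<eta>) * (real n + 1) / 2) * image_kernel n \<eta> x
         - b * (1 - \<eta> \<bullet> \<eta>) * euler (image_kernel n \<eta>) x)"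
    and "conformal_op n (regular_part n a b \<eta>) x
      = - 2 * fund_const n * (3 - real n) * (1 - \<eta> \<bullet> \<eta>) * (a + 2 * b) * image_kernel n \<eta> x"
proof -
  let ?\<Psi> = "\<lambda>x. quadratic (\<eta> \<bullet> \<eta>) 1 \<eta> x powr ((3 - real n) / 2)"
  let ?K = "\<lambda>x. (1 - x \<bullet> x) * image_kernel n \<eta> x"
  define c where "c = a * fund_const n"
  define d where "d = b * fund_const n * (3 - real n) / 2 * (1 - \<eta> \<bullet> \<eta>)"
  have R: "regular_part n a b \<eta> = (\<lambda>x. c * ?\<Psi> x + d * ?K x)"
    by (simp add: fun_eq_iff regular_part_def c_def d_def)
  have cc: "(\<eta> \<bullet> \<eta>) * 1 = \<eta> \<bullet> \<eta>" by simp
  have smQ: "smooth_on (image_kernel n \<eta>) V"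
    unfolding image_kernel_def[abs_def] using smooth_on_quadratic_powr[OF V(1) pos] .
  have sm\<Psi>: "smooth_on ?\<Psi> V" using smooth_on_quadratic_powr[OF V(1) pos] .
  have smK: "smooth_on ?K V" using V(1) smQ by (intro smooth_intros)
  have sm: "smooth_on (\<lambda>x. c * ?\<Psi> x) V" "smooth_on (\<lambda>x. d * ?K x) V"
    using smooth_on_mult[OF V(1) smooth_on_const] sm\<Psi> smK by blast+
  show "smooth_on (regular_part n a b \<eta>) V"
    unfolding R using V(1) sm by (rule smooth_on_add)
  have lapQ: "laplacian (image_kernel n \<eta>) x = 0"
    unfolding image_kernel_def[abs_def] using laplacian_quadratic_powr_harmonic[OF V pos cc n] .
  show "laplacian (regular_part n a b \<eta>) x = 2 * fund_const n * (3 - real n)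
      * ((a * (\<eta> \<bullet> \<eta>) - b * (1 - \<eta> \<bullet> \<eta>) * (real n + 1) / 2) * image_kernel n \<eta> x
         - b * (1 - \<eta> \<bullet> \<eta>) * euler (image_kernel n \<eta>) x)"
    unfolding R laplacian_add[OF V(1) sm V(2)] laplacian_cmult[OF V(1) sm\<Psi> V(2)]
      laplacian_cmult[OF V(1) smK V(2)] laplacian_one_minus_mult[OF V(1) smQ V(2)] lapQ
      laplacian_quadratic_powr_biharmonic[OF V pos cc n] image_kernel_def[symmetric] n
    unfolding c_def d_def by (simp add: field_simps)
  show "conformal_op n (regular_part n a b \<eta>) x
      = - 2 * fund_const n * (3 - real n) * (1 - \<eta> \<bullet> \<eta>) * (a + 2 * b) * image_kernel n \<eta> x"
    unfolding R conformal_op_add[OF V(1) sm V(2)] conformal_op_cmult[OF V(1) sm\<Psi> V(2)]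
      conformal_op_cmult[OF V(1) smK V(2)] conformal_op_one_minus_mult[OF V(1) smQ V(2) lapQ n]
      conformal_op_quadratic_powr[OF V pos cc n] image_kernel_def[symmetric]
    unfolding c_def d_def by (simp add: field_simps)
qed

text \<open>The Laplacian is a combination of \<open>image_kernel\<close> and its image under E, and
  both are harmonic.\<close>

lemma regular_part_biharmonic:
  fixes \<eta> x :: "'a::euclidean_space"
  assumes V: "open V" "x \<in> V" and pos: "\<forall>y\<in>V. quadratic (\<eta> \<bullet> \<eta>) 1 \<eta> y > 0"
    and n: "DIM('a) = n + 1"
  shows "laplacian (laplacian (regular_part n a b \<eta>)) x = 0"
proof -
  let ?Q = "image_kernel n \<eta>"
  define c where "c = 2 * fund_const n * (3 - real n) * (a * (\<eta> \<bullet> \<eta>) - b * (1 - \<eta> \<bullet> \<eta>) * (real n + 1) / 2)"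
  define d where "d = - 2 * fund_const n * (3 - real n) * b * (1 - \<eta> \<bullet> \<eta>)"
  have smQ: "smooth_on ?Q V"
    unfolding image_kernel_def[abs_def] using smooth_on_quadratic_powr[OF V(1) pos] .
  have smE: "smooth_on (euler ?Q) V" using V(1) smQ by (rule smooth_on_euler)
  have sm: "smooth_on (\<lambda>x. c * ?Q x) V" "smooth_on (\<lambda>x. d * euler ?Q x) V"
    using smooth_on_mult[OF V(1) smooth_on_const] smQ smE by blast+
  have lapQ: "laplacian ?Q y = 0" if "y \<in> V" for y
    unfolding image_kernel_def[abs_def]
    using laplacian_quadratic_powr_harmonic[OF V(1) that pos _ n] by simp
  have "laplacian (laplacian (regular_part n a b \<eta>)) x = laplacian (\<lambda>x. c * ?Q x + d * euler ?Q x) x"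
    by (intro laplacian_cong[OF V])
      (simp add: regular_part_operators(2)[OF V(1) _ pos n] c_def d_def algebra_simps)
  also have "\<dots> = c * laplacian ?Q x + d * (euler (laplacian ?Q) x + 2 * laplacian ?Q x)"
    unfolding laplacian_add[OF V(1) sm V(2)] laplacian_cmult[OF V(1) smQ V(2)]
      laplacian_cmult[OF V(1) smE V(2)] laplacian_euler[OF V(1) smQ V(2)] ..
  also have "euler (laplacian ?Q) x = euler (\<lambda>_. 0) x"
    by (rule euler_cong[OF V]) (rule lapQ)
  finally show ?thesis using lapQ[OF V(2)] by simp
qed

text \<open>Let D = E + (n - 1) / 2. \<open>conformal_op\<close> of the sum is a multiple of P - (a
  + 2 b) Q, so P = Q settles operator 1 and D P = - D Q settles operator 2. For operator 0 the
  factor 1 + a remains. For operator 3 the coefficients of D D Q and of D P both contain the factor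
  1 - a.\<close>

lemma bdry_op_green:
  fixes \<eta> \<xi> :: "'a::euclidean_space"
  assumes n: "DIM('a) = n + 1" "n \<ge> 2" "n \<noteq> 3"
    and \<eta>: "\<eta> \<in> ball 0 1" and \<xi>: "\<xi> \<in> sphere 0 1"
    and k: "k = 0 \<and> a = - 1 \<or> k = 1 \<and> a + 2 * b = 1 \<or> k = 2 \<and> a + 2 * b = - 1 \<or> k = 3 \<and> a = 1"
  shows "bdry_op n k (\<lambda>x. fund_sol n (norm (x - \<eta>)) + regular_part n a b \<eta> x) \<xi> = 0"
proof -
  let ?\<Phi> = "\<lambda>x. quadratic 1 (\<eta> \<bullet> \<eta>) \<eta> x powr ((3 - real n) / 2)"
  let ?H = "regular_part n a b \<eta>"
  let ?P = "pole_kernel n \<eta>"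
  let ?Q = "image_kernel n \<eta>"
  define g where "g = fund_const n"
  define d where "d = 2 * g * (3 - real n)"
  define \<tau> where "\<tau> = 1 - \<eta> \<bullet> \<eta>"
  define U where "U = (\<lambda>x. g * ?\<Phi> x + ?H x)"
  have U: "(\<lambda>x. fund_sol n (norm (x - \<eta>)) + ?H x) = U"
    unfolding fund_sol_norm[OF n(2,3)] U_def g_def ..
  define V where "V = quadratic (\<eta> \<bullet> \<eta>) 1 \<eta> -` {0<..} \<inter> - {\<eta>}"
  have "open (quadratic (\<eta> \<bullet> \<eta>) 1 \<eta> -` {0<..})"
    unfolding quadratic_def by (intro open_vimage open_greaterThan continuous_intros)
  then have oV: "open V" by (auto simp: V_def)
  have \<xi>V: "\<xi> \<in> V" using quadratic_image_pos[OF \<eta>, of \<xi>] \<xi> \<eta> by (auto simp: V_def)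
  have n\<xi>: "norm \<xi> = 1" using \<xi> by simp
  have xx: "\<xi> \<bullet> \<xi> = 1" using n\<xi> by (simp add: norm_eq_1)
  have pos: "\<forall>y\<in>V. quadratic (\<eta> \<bullet> \<eta>) 1 \<eta> y > 0"
    and pos1: "\<forall>y\<in>V. quadratic 1 (\<eta> \<bullet> \<eta>) \<eta> y > 0"
    by (auto simp: V_def quadratic_norm_pos)
  have cc: "1 * (\<eta> \<bullet> \<eta>) = \<eta> \<bullet> \<eta>" by simp
  have smP: "smooth_on ?P V"
    unfolding pole_kernel_def[abs_def] using smooth_on_quadratic_powr[OF oV pos1] .
  have smQ: "smooth_on ?Q V"
    unfolding image_kernel_def[abs_def] using smooth_on_quadratic_powr[OF oV pos] .
  have smEP: "smooth_on (euler ?P) V" and smEQ: "smooth_on (euler ?Q) V"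
    using oV smP smQ smooth_on_euler by auto
  have sm\<Phi>: "smooth_on ?\<Phi> V" using smooth_on_quadratic_powr[OF oV pos1] .
  have smg: "smooth_on (\<lambda>x. g * ?\<Phi> x) V" using smooth_on_mult[OF oV smooth_on_const sm\<Phi>] .
  have smH: "smooth_on ?H V" using regular_part_operators(1)[OF oV \<xi>V pos n(1)] .
  have smU: "smooth_on U V" unfolding U_def using oV smg smH by (rule smooth_on_add)
  have diff: "f differentiable (at x)" if "smooth_on f V" "x \<in> V" for f x
    using smooth_on_imp_differentiable[OF that] .
  define c where "c = a + 2 * b"
  have C: "conformal_op n U x = d * \<tau> * ?P x + (- d * \<tau> * c) * ?Q x" if x: "x \<in> V" for x
    unfolding U_def conformal_op_add[OF oV smg smH x] conformal_op_cmult[OF oV sm\<Phi> x]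
      conformal_op_quadratic_powr[OF oV x pos1 cc n(1)] regular_part_operators(3)[OF oV x pos n(1)]
      pole_kernel_def[symmetric]
    by (simp add: d_def g_def \<tau>_def c_def algebra_simps)
  define e where "e = d * (a * (\<eta> \<bullet> \<eta>) - b * \<tau> * (real n + 1) / 2)"
  have L: "laplacian U x = d * ?P x + e * ?Q x + (- d * b * \<tau>) * euler ?Q x" if x: "x \<in> V" for x
    unfolding U_def laplacian_add[OF oV smg smH x] laplacian_cmult[OF oV sm\<Phi> x]
      laplacian_quadratic_powr_biharmonic[OF oV x pos1 cc n(1)] regular_part_operators(2)[OF oV x pos n(1)]
      pole_kernel_def[symmetric]
    by (simp add: d_def g_def \<tau>_def e_def algebra_simps)
  have comb: "euler (\<lambda>x. r * f x + s * h x) x = r * euler f x + s * euler h x"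
    if "f differentiable (at x)" "h differentiable (at x)" for r s f h and x :: 'a
    using that by (simp add: euler_add euler_cmult)
  have EC: "euler (conformal_op n U) x = d * \<tau> * euler ?P x + (- d * \<tau> * c) * euler ?Q x"
    if x: "x \<in> V" for x
    by (rule trans[OF euler_cong[OF oV x C] comb[OF diff[OF smP x] diff[OF smQ x]]])
  have EEC: "euler (euler (conformal_op n U)) x
      = d * \<tau> * euler (euler ?P) x + (- d * \<tau> * c) * euler (euler ?Q) x" if x: "x \<in> V" for x
    by (rule trans[OF euler_cong[OF oV x EC] comb[OF diff[OF smEP x] diff[OF smEQ x]]])
  have EL: "euler (laplacian U) x = d * euler ?P x + e * euler ?Q x + (- d * b * \<tau>) * euler (euler ?Q) x"
    if x: "x \<in> V" for x
  proof -
    have "euler (laplacian U) x = euler (\<lambda>x. (d * ?P x + e * ?Q x) + (- d * b * \<tau>) * euler ?Q x) x"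
      by (rule euler_cong[OF oV x L])
    also have "\<dots> = euler (\<lambda>x. d * ?P x + e * ?Q x) x + euler (\<lambda>x. (- d * b * \<tau>) * euler ?Q x) x"
      using diff[OF smP x] diff[OF smQ x] diff[OF smEQ x]
      by (intro euler_add differentiable_add differentiable_mult differentiable_const)
    also have "\<dots> = d * euler ?P x + e * euler ?Q x + (- d * b * \<tau>) * euler (euler ?Q) x"
      unfolding comb[OF diff[OF smP x] diff[OF smQ x]] euler_cmult[OF diff[OF smEQ x]] ..
    finally show ?thesis .
  qed
  note sph = kernels_on_sphere[OF \<eta> n\<xi>, of n]
  \<comment> \<open>On the sphere the values of P, Q and of their first two derivatives under E are
    determined by the three numbers \<open>q\<close>, \<open>y\<close> and \<open>z\<close>. In
    these the boundary conditions become algebraic identities.\<close>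
  define m where "m = real n - 1"
  define q where "q = ?Q \<xi>"
  define y where "y = euler ?P \<xi>"
  define z where "z = euler (euler ?P) \<xi>"
  have P: "?P \<xi> = q" using sph(1) by (simp add: q_def)
  have EQ: "euler ?Q \<xi> = - m * q - y" using sph(2) by (simp add: q_def m_def y_def)
  have EEQ: "euler (euler ?Q) \<xi> = z + m * y + m * (m * q + y)"
    using sph(3) EQ by (simp add: q_def m_def y_def z_def algebra_simps)
  have nm: "real n = m + 1" by (simp add: m_def)
  note vals = C[OF \<xi>V] EC[OF \<xi>V] EEC[OF \<xi>V] L[OF \<xi>V] EL[OF \<xi>V]
  from k consider "k = 0" "a = - 1" | "k = 1" "c = 1" | "k = 2" "c = - 1" | "k = 3" "a = 1"
    unfolding c_def by blast
  then show ?thesis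
  proof cases
    case 1
    have "quadratic 1 (\<eta> \<bullet> \<eta>) \<eta> \<xi> = quadratic (\<eta> \<bullet> \<eta>) 1 \<eta> \<xi>"
      by (simp add: quadratic_def xx)
    then show ?thesis
      unfolding U using 1 by (simp add: U_def bdry_op_def bdry_op0_def regular_part_def xx g_def)
  next
    case 2
    then show ?thesis
      unfolding U by (simp add: bdry_op_def bdry_op1_eq[OF n\<xi>] vals P q_def[symmetric])
  next
    case 3
    then show ?thesis
      unfolding U
      by (simp add: bdry_op_def bdry_op2_eq[OF oV smU \<xi>V n\<xi> n(1)] vals P EQ q_def[symmetric]
          y_def[symmetric] nm) (simp add: field_simps)
  next
    case 4
    have "bdry_op3 n U \<xi> = 0"
      unfolding bdry_op3_eq[OF oV smU \<xi>V n\<xi> n(1)] vals P EQ EEQ q_def[symmetric] y_def[symmetric]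
        z_def[symmetric] nm e_def c_def 4(2) \<tau>_def
      by (simp add: field_simps power2_eq_square)
    then show ?thesis unfolding U using 4 by (simp add: bdry_op_def)
  qed
qed

text \<open>Operators 0 and 3 fix \<open>a\<close>, operators 1 and 2 fix \<open>a + 2 * b\<close>.
  An admissible pair has one member of each kind and so determines both parameters. The
  neighbourhood for the smooth extension is the set where the image quadratic is positive.\<close>

lemma is_green_regular_part:
  fixes G :: "'a::euclidean_space \<Rightarrow> 'a \<Rightarrow> ereal"
  assumes n: "DIM('a) = n + 1" "n \<ge> 2" "n \<noteq> 3" and ij: "i < j" "j \<le> 3" "i + j \<noteq> 3"
    and a: "a = (if i = 0 then - 1 else 1)"
    and b: "a + 2 * b = (if i = 1 \<or> j = 1 then 1 else - 1)"
    and fin: "\<And>\<xi> \<eta>. G \<xi> \<eta> \<noteq> -\<infinity>"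
    and G: "\<And>\<xi> \<eta>. \<xi> \<in> cball 0 1 \<Longrightarrow> \<eta> \<in> ball 0 1
      \<Longrightarrow> G \<xi> \<eta> = fund_sol_ext n (norm (\<xi> - \<eta>)) + ereal (regular_part n a b \<eta> \<xi>)"
  shows "is_green n i j G"
  unfolding is_green_def
proof (intro conjI ballI)
  fix \<eta> :: 'a assume \<eta>: "\<eta> \<in> ball 0 1"
  define V where "V = quadratic (\<eta> \<bullet> \<eta>) 1 \<eta> -` {0<..}"
  have V: "open V"
    unfolding V_def quadratic_def by (intro open_vimage open_greaterThan continuous_intros)
  have sub: "cball 0 1 \<subseteq> V" using quadratic_image_pos[OF \<eta>] by (auto simp: V_def)
  have pos: "\<forall>y\<in>V. quadratic (\<eta> \<bullet> \<eta>) 1 \<eta> y > 0" by (simp add: V_def)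
  have i: "i = 0 \<and> a = - 1 \<or> i = 1 \<and> a + 2 * b = 1 \<or> i = 2 \<and> a + 2 * b = - 1 \<or> i = 3 \<and> a = 1"
    and j: "j = 0 \<and> a = - 1 \<or> j = 1 \<and> a + 2 * b = 1 \<or> j = 2 \<and> a + 2 * b = - 1 \<or> j = 3 \<and> a = 1"
    using a b ij by (auto split: if_splits)
  have "0 \<in> V" using sub by auto
  show "\<exists>V H. open V \<and> cball 0 1 \<subseteq> V \<and> smooth_on H V \<and>
        (\<forall>\<xi>\<in>cball 0 1. G \<xi> \<eta> = fund_sol_ext n (norm (\<xi> - \<eta>)) + ereal (H \<xi>)) \<and>
        (\<forall>\<xi>\<in>ball 0 1. laplacian (laplacian H) \<xi> = 0) \<and>
        (\<forall>\<xi>\<in>sphere 0 1. bdry_op n i (\<lambda>x. fund_sol n (norm (x - \<eta>)) + H x) \<xi> = 0) \<and>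
        (\<forall>\<xi>\<in>sphere 0 1. bdry_op n j (\<lambda>x. fund_sol n (norm (x - \<eta>)) + H x) \<xi> = 0)"
  proof (intro exI[of _ V] exI[of _ "regular_part n a b \<eta>"] conjI ballI)
    show "smooth_on (regular_part n a b \<eta>) V"
      using regular_part_operators(1)[OF V \<open>0 \<in> V\<close> pos n(1)] .
    fix \<xi> :: 'a
    show "laplacian (laplacian (regular_part n a b \<eta>)) \<xi> = 0" if "\<xi> \<in> ball 0 1"
      by (rule regular_part_biharmonic[OF V _ pos n(1)]) (use that sub in auto)
    show "bdry_op n i (\<lambda>x. fund_sol n (norm (x - \<eta>)) + regular_part n a b \<eta> x) \<xi> = 0"
      if "\<xi> \<in> sphere 0 1"
      by (rule bdry_op_green[OF n \<eta> that i])
    show "bdry_op n j (\<lambda>x. fund_sol n (norm (x - \<eta>)) + regular_part n a b \<eta> x) \<xi> = 0"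
      if "\<xi> \<in> sphere 0 1"
      by (rule bdry_op_green[OF n \<eta> that j])
  qed (use V sub G \<eta> in auto)
qed (use ij fin in auto)

text \<open>With q the square of \<open>refl_dist\<close> and T = (1 - |\<xi>|^2)(1 - |\<eta>|^2),
  the squared distance is q - T. Half the bracket is then -1 - (n - 3) T / (2 q), and its two terms
  are those of \<open>regular_part\<close> with \<open>a = - 1\<close> and
  \<open>b = 1\<close>.\<close>

lemma image_term_eq_regular_part:
  fixes \<xi> \<eta> :: "'a::euclidean_space"
  assumes n: "n \<ge> 2" "n \<noteq> 3" and \<eta>: "\<eta> \<in> ball 0 1" and \<xi>: "\<xi> \<in> cball 0 1"
  shows "fund_sol n (refl_dist \<xi> \<eta>) = regular_part n 1 0 \<eta> \<xi>"
    and "1 / 2 * fund_sol n (refl_dist \<xi> \<eta>)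
         * ((real n - 3) * ((norm (\<xi> - \<eta>))\<^sup>2 / (refl_dist \<xi> \<eta>)\<^sup>2) - (real n - 1))
       = regular_part n (- 1) 1 \<eta> \<xi>"
proof -
  define q where "q = quadratic (\<eta> \<bullet> \<eta>) 1 \<eta> \<xi>"
  define T where "T = (1 - \<xi> \<bullet> \<xi>) * (1 - \<eta> \<bullet> \<eta>)"
  have q: "q > 0" using quadratic_image_pos[OF \<eta> \<xi>] by (simp add: q_def)
  have f: "fund_sol n (refl_dist \<xi> \<eta>) = fund_const n * q powr ((3 - real n) / 2)"
    using fund_sol_sqrt[OF less_imp_le[OF q] n] by (simp add: refl_dist_eq_quadratic q_def)
  then show "fund_sol n (refl_dist \<xi> \<eta>) = regular_part n 1 0 \<eta> \<xi>"
    by (simp add: regular_part_def q_def)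
  have e2: "(3 - real n) / 2 = (1 - real n) / 2 + 1" by (simp add: field_simps)
  have pq: "q powr ((3 - real n) / 2) = image_kernel n \<eta> \<xi> * q"
    unfolding e2 powr_add image_kernel_def using q by (simp add: q_def)
  have r: "(refl_dist \<xi> \<eta>)\<^sup>2 = q" using q by (simp add: refl_dist_eq_quadratic q_def)
  have A: "(norm (\<xi> - \<eta>))\<^sup>2 = q - T"
    unfolding norm_diff_eq_quadratic by (simp add: q_def T_def quadratic_def algebra_simps)
  show "1 / 2 * fund_sol n (refl_dist \<xi> \<eta>)
         * ((real n - 3) * ((norm (\<xi> - \<eta>))\<^sup>2 / (refl_dist \<xi> \<eta>)\<^sup>2) - (real n - 1))
       = regular_part n (- 1) 1 \<eta> \<xi>"
    unfolding f r A regular_part_def q_def[symmetric] pq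
    using q by (simp add: T_def field_simps)
qed

lemma regular_part_uminus: "regular_part n (- a) (- b) \<eta> x = - regular_part n a b \<eta> x"
  by (simp add: regular_part_def)

lemma is_green_explicit:
  assumes n: "DIM('a::euclidean_space) = n + 1" "n \<ge> 2" "n \<noteq> 3"
  shows "is_green n 0 1 (green01 n :: 'a \<Rightarrow> 'a \<Rightarrow> ereal)"
    and "is_green n 2 3 (green23 n :: 'a \<Rightarrow> 'a \<Rightarrow> ereal)"
    and "is_green n 0 2 (green02 n :: 'a \<Rightarrow> 'a \<Rightarrow> ereal)"
    and "is_green n 1 3 (green13 n :: 'a \<Rightarrow> 'a \<Rightarrow> ereal)"
proof -
  have fin: "fund_sol_ext n \<rho> + ereal r \<noteq> -\<infinity>" "fund_sol_ext n \<rho> - ereal r \<noteq> -\<infinity>" for \<rho> r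
    by (simp_all add: fund_sol_ext_def)
  have minus: "x - ereal r = x + ereal (- r)" for x r
    by (cases x) auto
  show "is_green n 0 1 (green01 n :: 'a \<Rightarrow> 'a \<Rightarrow> ereal)"
    by (rule is_green_regular_part[where a = "- 1" and b = 1])
      (use n fin in \<open>auto simp: green01_def image_term_eq_regular_part(2)[symmetric]\<close>)
  show "is_green n 2 3 (green23 n :: 'a \<Rightarrow> 'a \<Rightarrow> ereal)"
  proof (rule is_green_regular_part[where a = 1 and b = "- 1"])
    fix \<xi> \<eta> :: 'a assume "\<xi> \<in> cball 0 1" "\<eta> \<in> ball 0 1"
    then show "green23 n \<xi> \<eta> = fund_sol_ext n (norm (\<xi> - \<eta>)) + ereal (regular_part n 1 (- 1) \<eta> \<xi>)"
      unfolding green23_def image_term_eq_regular_part(2)[OF n(2,3) \<open>\<eta> \<in> ball 0 1\<close> \<open>\<xi> \<in> cball 0 1\<close>] minus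
      using regular_part_uminus[of n "- 1" 1 \<eta> \<xi>] by simp
  qed (use n fin in \<open>auto simp: green23_def\<close>)
  show "is_green n 0 2 (green02 n :: 'a \<Rightarrow> 'a \<Rightarrow> ereal)"
  proof (rule is_green_regular_part[where a = "- 1" and b = 0])
    fix \<xi> \<eta> :: 'a assume "\<xi> \<in> cball 0 1" "\<eta> \<in> ball 0 1"
    then show "green02 n \<xi> \<eta> = fund_sol_ext n (norm (\<xi> - \<eta>)) + ereal (regular_part n (- 1) 0 \<eta> \<xi>)"
      unfolding green02_def image_term_eq_regular_part(1)[OF n(2,3) \<open>\<eta> \<in> ball 0 1\<close> \<open>\<xi> \<in> cball 0 1\<close>] minus
      using regular_part_uminus[of n 1 0 \<eta> \<xi>] by simp
  qed (use n fin in \<open>auto simp: green02_def\<close>)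
  show "is_green n 1 3 (green13 n :: 'a \<Rightarrow> 'a \<Rightarrow> ereal)"
    by (rule is_green_regular_part[where a = 1 and b = 0])
      (use n fin in \<open>auto simp: green13_def image_term_eq_regular_part(1)\<close>)
qed

section \<open>The order of the kernels\<close>

text \<open>The factor n - 3 in the denominator cancels. Thus the constant has the sign of n - 3,
  which is negative for \<open>n = 2\<close>.\<close>

lemma fund_const_mult_pos:
  assumes "n \<ge> 2" "n \<noteq> 3"
  shows "fund_const n * (real n - 3) > 0"
proof -
  have "sphere_area n > 0" by (simp add: sphere_area_def)
  moreover have "fund_const n * (real n - 3) = 1 / (2 * (real n - 1) * sphere_area n)"
    using assms(2) by (simp add: fund_const_def)
  ultimately show ?thesis using assms by simp
qed

text \<open>Strict convexity at 1: the power is exp (m ln u), which is at least 1 + m ln u, and ln u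
  < u - 1 is multiplied by the negative \<open>m\<close>.\<close>

lemma powr_gt_tangent:
  fixes u m :: real
  assumes "u > 0" "u \<noteq> 1" "m < 0"
  shows "u powr m > 1 + m * (u - 1)"
proof -
  have "ln u < u - 1"
    using ln_le_minus_one[OF assms(1)] ln_eq_minus_one[OF assms(1)] assms(2) by linarith
  then have "m * (u - 1) < m * ln u" using assms(3) by simp
  also have "1 + m * ln u \<le> u powr m"
    using exp_ge_add_one_self[of "m * ln u"] assms(1) by (simp add: powr_def)
  finally show ?thesis by simp
qed

text \<open>For \<open>n > 3\<close> the power is convex and the constant positive. For
  \<open>n = 2\<close> the power is the concave square root and the constant negative; the gap is
  then -(1 - sqrt u)^2 / 2, and the two signs cancel.\<close>

lemma green_gap_pos:
  fixes u :: real
  assumes n: "n \<ge> 2" "n \<noteq> 3" and u: "0 < u" "u < 1"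
  shows "fund_const n * (u powr ((3 - real n) / 2) - 1 - (3 - real n) / 2 * (u - 1)) > 0"
proof (cases "n = 2")
  case True
  then have "fund_const n < 0" using fund_const_mult_pos[OF n] by simp
  have "sqrt u \<noteq> 1" using u by simp
  then have "(1 - sqrt u)\<^sup>2 > 0" by simp
  then have "sqrt u - 1 - 1 / 2 * (u - 1) < 0"
    using u by (simp add: power2_diff)
  then show ?thesis
    using True \<open>fund_const n < 0\<close> u by (simp add: powr_half_sqrt mult_neg_neg)
next
  case False
  then have m: "(3 - real n) / 2 < 0" using n by simp
  have "fund_const n > 0"
    using fund_const_mult_pos[OF n] False n by (simp add: zero_less_mult_iff)
  moreover have "u powr ((3 - real n) / 2) - 1 - (3 - real n) / 2 * (u - 1) > 0"
    using powr_gt_tangent[OF u(1) _ m] u by simp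
  ultimately show ?thesis by (rule mult_pos_pos)
qed

text \<open>Let u be the quotient of the squared distances to the pole and to the image; it lies in
  (0, 1] and is 1 exactly when a point is on the sphere. Every kernel is the image term S times a
  function of u. The first is the tangent gap, and the steps from \<open>green01\<close> to
  \<open>green02\<close> and from \<open>green13\<close> to \<open>green23\<close> both equal S m (u
  - 1) with m = (3 - n) / 2. The kernels \<open>green02\<close> and \<open>green13\<close> differ by
  2 S, which has the sign of n - 3 and never vanishes, even on the sphere; so this comparison is
  strict and is reversed for \<open>n = 2\<close>.\<close>

lemma green_order:
  fixes \<xi> \<eta> :: "'a::euclidean_space"
  assumes n: "n \<ge> 2" "n \<noteq> 3" and \<xi>: "\<xi> \<in> cball 0 1" and \<eta>: "\<eta> \<in> cball 0 1" and ne: "\<xi> \<noteq> \<eta>"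
  shows "0 \<le> green01 n \<xi> \<eta> \<and>
        green01 n \<xi> \<eta> \<le> green02 n \<xi> \<eta> \<and>
        (n > 3 \<longrightarrow> green02 n \<xi> \<eta> < green13 n \<xi> \<eta>) \<and>
        (n = 2 \<longrightarrow> green13 n \<xi> \<eta> < green02 n \<xi> \<eta>) \<and>
        green13 n \<xi> \<eta> \<le> green23 n \<xi> \<eta> \<and>
        (green01 n \<xi> \<eta> = 0 \<longleftrightarrow> \<xi> \<in> sphere 0 1 \<or> \<eta> \<in> sphere 0 1) \<and>
        (green01 n \<xi> \<eta> = green02 n \<xi> \<eta> \<longleftrightarrow> \<xi> \<in> sphere 0 1 \<or> \<eta> \<in> sphere 0 1) \<and>
        (green13 n \<xi> \<eta> = green23 n \<xi> \<eta> \<longleftrightarrow> \<xi> \<in> sphere 0 1 \<or> \<eta> \<in> sphere 0 1)"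
proof -
  define m where "m = (3 - real n) / 2"
  define g where "g = fund_const n"
  define A where "A = (norm (\<xi> - \<eta>))\<^sup>2"
  define B where "B = A + (1 - (norm \<xi>)\<^sup>2) * (1 - (norm \<eta>)\<^sup>2)"
  define u where "u = A / B"
  have A: "A > 0" using ne by (simp add: A_def)
  have le: "(norm \<xi>)\<^sup>2 \<le> 1" "(norm \<eta>)\<^sup>2 \<le> 1"
    using \<xi> \<eta> by (simp_all add: power_le_one)
  then have AB: "A \<le> B" by (simp add: B_def)
  then have B: "B > 0" using A by simp
  have eqAB: "A = B \<longleftrightarrow> \<xi> \<in> sphere 0 1 \<or> \<eta> \<in> sphere 0 1"
    by (auto simp: B_def norm_eq_1 power2_norm_eq_inner)
  have u: "0 < u" "u \<le> 1" using A B AB by (simp_all add: u_def)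
  have u1: "u = 1 \<longleftrightarrow> \<xi> \<in> sphere 0 1 \<or> \<eta> \<in> sphere 0 1"
    using B eqAB by (auto simp: u_def)
  have rd: "refl_dist \<xi> \<eta> = sqrt B" by (simp add: refl_dist_def B_def A_def)
  have F: "fund_sol_ext n (norm (\<xi> - \<eta>)) = ereal (g * A powr m)"
  proof -
    have "norm (\<xi> - \<eta>) = sqrt A" by (simp add: A_def)
    then show ?thesis
      using A fund_sol_sqrt[OF less_imp_le[OF A] n] by (simp add: fund_sol_ext_def g_def m_def)
  qed
  have R: "fund_sol n (refl_dist \<xi> \<eta>) = g * B powr m"
    using fund_sol_sqrt[OF less_imp_le[OF B] n] by (simp add: rd g_def m_def)
  define S where "S = g * B powr m"
  have X: "1 / 2 * fund_sol n (refl_dist \<xi> \<eta>)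
         * ((real n - 3) * ((norm (\<xi> - \<eta>))\<^sup>2 / (refl_dist \<xi> \<eta>)\<^sup>2) - (real n - 1))
      = - S - S * m * (u - 1)"
    unfolding R S_def[symmetric] using B by (simp add: rd m_def u_def A_def[symmetric] field_simps)
  have FA: "g * A powr m = S * u powr m"
    using A B by (simp add: S_def u_def powr_divide)
  have e01: "green01 n \<xi> \<eta> = ereal (S * (u powr m - 1 - m * (u - 1)))"
    unfolding green01_def F X FA by (simp add: algebra_simps)
  have e02: "green02 n \<xi> \<eta> = ereal (S * u powr m - S)"
    unfolding green02_def F R FA S_def[symmetric] by simp
  have e13: "green13 n \<xi> \<eta> = ereal (S * u powr m + S)"
    unfolding green13_def F R FA S_def[symmetric] by simp
  have e23: "green23 n \<xi> \<eta> = ereal (S * u powr m + S + S * m * (u - 1))"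
    unfolding green23_def F X FA by simp
  have gap: "S * (u powr m - 1 - m * (u - 1)) > 0" if "u \<noteq> 1"
  proof -
    have "g * (u powr m - 1 - m * (u - 1)) > 0"
      using green_gap_pos[OF n u(1)] u(2) that by (simp add: g_def m_def)
    moreover have "B powr m > 0" using B by simp
    ultimately have "B powr m * (g * (u powr m - 1 - m * (u - 1))) > 0" by simp
    then show ?thesis by (simp add: S_def mult_ac)
  qed
  \<comment> \<open>\<open>S\<close> has the sign of n - 3 and \<open>m\<close> the opposite sign,
    so one argument covers \<open>n = 2\<close> and \<open>n > 3\<close>.\<close>
  have Sm: "S * m < 0"
  proof -
    have "g * m < 0" using fund_const_mult_pos[OF n] by (simp add: g_def m_def field_simps)
    moreover have "B powr m > 0" using B by simp
    ultimately have "B powr m * (g * m) < 0" by (rule mult_pos_neg[rotated])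
    then show ?thesis by (simp add: S_def mult_ac)
  qed
  have Smu: "S * m * (u - 1) > 0" if "u \<noteq> 1"
    using Sm u that by (intro mult_neg_neg) auto
  have S3: "S > 0" if "n > 3" using Sm that by (simp add: m_def mult_less_0_iff)
  have S2: "S < 0" if "n = 2" using Sm that by (simp add: m_def mult_less_0_iff)
  have d12: "S * (u powr m - 1 - m * (u - 1)) = S * u powr m - S - S * m * (u - 1)"
    by (simp add: algebra_simps)
  show ?thesis
  proof (cases "u = 1")
    case True
    then show ?thesis
      unfolding e01 e02 e13 e23 u1[symmetric] using S2 S3 by auto
  next
    case False
    then show ?thesis
      unfolding e01 e02 e13 e23 u1[symmetric] using gap Smu S2 S3
      by (auto simp: d12)
  qed
qed

text \<open>\<open>is_green\<close> determines values only for \<eta> in the open ball, so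
  uniqueness is asserted there. The order is stated for the explicit kernels, which makes sense also
  for \<eta> on the sphere.\<close>

theorem theorem4p1:
  fixes n :: nat
  assumes "DIM('a::euclidean_space) = n + 1" and "n \<ge> 2" and "n \<noteq> 3"
  shows
    "(is_green n 0 1 (green01 n :: 'a \<Rightarrow> 'a \<Rightarrow> ereal) \<and>
      is_green n 2 3 (green23 n :: 'a \<Rightarrow> 'a \<Rightarrow> ereal) \<and>
      is_green n 0 2 (green02 n :: 'a \<Rightarrow> 'a \<Rightarrow> ereal) \<and>
      is_green n 1 3 (green13 n :: 'a \<Rightarrow> 'a \<Rightarrow> ereal)) \<and>
     (\<forall>G :: 'a \<Rightarrow> 'a \<Rightarrow> ereal.
      (is_green n 0 1 G \<longrightarrow> (\<forall>\<xi>\<in>cball 0 1. \<forall>\<eta>\<in>ball 0 1. \<xi> \<noteq> \<eta> \<longrightarrow> G \<xi> \<eta> = green01 n \<xi> \<eta>)) \<and>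
      (is_green n 2 3 G \<longrightarrow> (\<forall>\<xi>\<in>cball 0 1. \<forall>\<eta>\<in>ball 0 1. \<xi> \<noteq> \<eta> \<longrightarrow> G \<xi> \<eta> = green23 n \<xi> \<eta>)) \<and>
      (is_green n 0 2 G \<longrightarrow> (\<forall>\<xi>\<in>cball 0 1. \<forall>\<eta>\<in>ball 0 1. \<xi> \<noteq> \<eta> \<longrightarrow> G \<xi> \<eta> = green02 n \<xi> \<eta>)) \<and>
      (is_green n 1 3 G \<longrightarrow> (\<forall>\<xi>\<in>cball 0 1. \<forall>\<eta>\<in>ball 0 1. \<xi> \<noteq> \<eta> \<longrightarrow> G \<xi> \<eta> = green13 n \<xi> \<eta>))) \<and>
     (\<forall>\<xi>\<in>cball (0::'a) 1. \<forall>\<eta>\<in>cball 0 1. \<xi> \<noteq> \<eta> \<longrightarrow>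
        0 \<le> green01 n \<xi> \<eta> \<and>
        green01 n \<xi> \<eta> \<le> green02 n \<xi> \<eta> \<and>
        (n > 3 \<longrightarrow> green02 n \<xi> \<eta> < green13 n \<xi> \<eta>) \<and>
        (n = 2 \<longrightarrow> green13 n \<xi> \<eta> < green02 n \<xi> \<eta>) \<and>
        green13 n \<xi> \<eta> \<le> green23 n \<xi> \<eta> \<and>
        (green01 n \<xi> \<eta> = 0 \<longleftrightarrow> \<xi> \<in> sphere 0 1 \<or> \<eta> \<in> sphere 0 1) \<and>
        (green01 n \<xi> \<eta> = green02 n \<xi> \<eta> \<longleftrightarrow> \<xi> \<in> sphere 0 1 \<or> \<eta> \<in> sphere 0 1) \<and>
        (green13 n \<xi> \<eta> = green23 n \<xi> \<eta> \<longleftrightarrow> \<xi> \<in> sphere 0 1 \<or> \<eta> \<in> sphere 0 1))"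
proof (rule conjI[OF _ conjI], goal_cases)
  case 1
  show ?case using is_green_explicit[OF assms] by blast
next
  case 2
  \<comment> \<open>The rotation of the premises puts the explicit kernel in the place of
    \<open>G'\<close>, so it stands on the right of the resulting equations.\<close>
  note unique = is_green_explicit[OF assms, THEN is_green_unique[OF assms, rotated]]
  show ?case using unique by blast
next
  case 3
  show ?case using green_order[OF assms(2,3)] by blast
qed

end
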